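(* Let $\{X_n\}_{n\ge 0}$ be a two-type branching process with immigration (with the notation fixed in the context) such that $f(\mathbf 0)=\mathbf 0$, the mean matrix $M$ is positively regular, and its maximal eigenvalue satisfies $\rho>1$. Let $$Y_n=\rho^{-n}\Big(\boldsymbol u\cdot X_n-\frac{\rho^{n+1}-1}{\rho-1}(\boldsymbol u\cdot\boldsymbol\lambda)\Big),\qquad n\ge0,$$ and let $Y$ be the almost sure limit of $Y_n$ as $n\to\infty$. Assume that $E_i\big(e^{\theta_0(\mathbf 1\cdot X_1)}\big)<\infty$ for some $\theta_0>0$ and $i=1,2$. Then there are constants $0<C_5,C_6,C_7,C_8<\infty$ and $0<\kappa_2,\kappa_3<\infty$ such that for every $\varepsilon>0$, $\alpha>0$ and $\boldsymbol l\in\mathbb R^2$ with $\boldsymbol l\ne\mathbf 0$, one can find $0<\Lambda(\varepsilon)<\infty$ such that, for $i=1,2$ and all $n\ge1$, $$P_i\Big(\Big|\frac{\boldsymbol l\cdot X_{n+1}}{\mathbf 1\cdot X_n}-\frac{\boldsymbol l\cdot(X_nM)}{\mathbf 1\cdot X_n}\Big|>\varepsilon\,\Big|\,Y\ge\alpha\Big)\le C_5e^{-\alpha\beta\Lambda(\varepsilon)\rho^n}+C_6e^{-\kappa_2(\alpha(1-\beta))^{2/3}(\rho^{1/3})^n}$$ and $$P_i\Big(\Big|\frac{\boldsymbol l\cdot X_n}{\mathbf 1\cdot X_n}-\frac{\boldsymbol l\cdot\boldsymbol v}{\mathbf 1\cdot\boldsymbol v}\Big|>\varepsilon\,\Big|\,Y\ge\alpha\Big)\le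 C_7e^{-\alpha\beta\Lambda(\varepsilon)\rho^n}+C_8e^{-\kappa_3(\alpha(1-\beta))^{2/3}(\rho^{1/3})^n}$$ for every $0<\beta<1$.
   Context: $\mathbb N=\{0,1,2,\dots\}$, $\mathbf 1=(1,1)$, $\mathbf 0=(0,0)$, $e_1=(1,0)$, $e_2=(0,1)$; vectors are row vectors and $\cdot$ is the Euclidean inner product. $\{Z_n\}_{n\ge0}$, $Z_n=(Z_n^{(1)},Z_n^{(2)})$, is a two-type Galton–Watson branching process: each particle of type $i$ independently produces, in the next generation, a random vector of offspring with law $P_i(j_1,j_2)=P(Z_1=(j_1,j_2)\mid Z_0=e_i)$. Its offspring generating functions are $f^{(i)}(\boldsymbol s)=\sum_{\boldsymbol j\in\mathbb N^2}P_i(j_1,j_2)s_1^{j_1}s_2^{j_2}$, $i=1,2$, $\boldsymbol s\in[0,1]^2$, and $f=(f^{(1)},f^{(2)})$. $I_1,I_2,\dots$ are i.i.d. $\mathbb N^2$-valued immigration vectors, independent of the reproduction, with mean $\boldsymbol\lambda=E(I_1)=(\lambda_1,\lambda_2)$. The process with immigration is $X_0=Z_0$, $X_n=Z_n+U_n^{(1)}+\cdots+U_n^{(n)}$ for $n\ge1$, where $U_n^{(k)}$ is the vector of numbers of descendants, in generation $n$, of the $k$-th immigration $I_k$ (so $U_n^{(n)}=I_n$); all particles reproduce independently with the same offspring laws. Equivalently, given $X_n=\boldsymbol j$, $X_{n+1}$ is the sum of the offspring vectors of the $j_1$ particles of type 1 and the $j_2$ particles of type 2 plus the independent vector $I_{n+1}$.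 $P_i$ and $E_i$ denote probability and expectation given $X_0=e_i$; conditioning on the event $\{Y\ge\alpha\}$ is elementary conditioning, $P_i(B\mid Y\ge\alpha)=P_i(B\cap\{Y\ge\alpha\})/P_i(Y\ge\alpha)$. $M=(m_{ij})$ with $m_{ij}=\partial f^{(i)}/\partial s_j(\mathbf 1^-)$ is the mean matrix (with finite entries). Positively regular means that some power of $M$ has all entries strictly positive; $\rho$ is then the maximal (Perron–Frobenius) eigenvalue of $M$, with strictly positive left eigenvector $\boldsymbol v$ and right eigenvector $\boldsymbol u$ normalized by $\boldsymbol v\cdot\boldsymbol u=1$, $\boldsymbol u\cdot\mathbf 1=1$. The sequence $(Y_n)$ is a martingale that converges almost surely, so $Y$ is well defined. *)

theory Defs
  imports "HOL-Probability.Probability"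
begin

text \<open>
  Particle types are the elements of the index type \<open>2\<close>; population vectors have type
  \<open>nat ^ 2\<close>, and \<open>1 :: real ^ 2\<close> is the vector (1,1).
\<close>

definition rvec :: "nat ^ 2 \<Rightarrow> real ^ 2"
  where "rvec x = (\<chi> t. real (x $ t))"

definition offspring_gf :: "(2 \<Rightarrow> (nat ^ 2) pmf) \<Rightarrow> real ^ 2 \<Rightarrow> real ^ 2"
  where "offspring_gf p s = (\<chi> i. \<Sum>\<^sub>\<infinity>j. pmf (p i) j * (\<Prod>t\<in>UNIV. (s $ t) ^ (j $ t)))"

text \<open>
  The entries are one-sided partial derivatives at (1,1); since they are real numbers, this
  includes the finiteness of the means.
\<close>

definition is_mean_matrix :: "(2 \<Rightarrow> (nat ^ 2) pmf) \<Rightarrow> real ^ 2 ^ 2 \<Rightarrow> bool"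
  where "is_mean_matrix p M \<longleftrightarrow>
    (\<forall>i j. ((\<lambda>s. offspring_gf p (\<chi> t. if t = j then s else 1) $ i)
              has_real_derivative M $ i $ j) (at_left 1))"

text \<open>\<open>M ^ k\<close> would be the entrywise power, hence the iterated \<open>**\<close>.\<close>

definition positively_regular :: "real ^ 2 ^ 2 \<Rightarrow> bool"
  where "positively_regular M \<longleftrightarrow> (\<exists>k. \<forall>i j. (((**) M ^^ k) (mat 1)) $ i $ j > 0)"

text \<open>Maximality is with respect to the modulus, among all complex eigenvalues.\<close>

definition maximal_eigenvalue :: "real ^ 2 ^ 2 \<Rightarrow> real \<Rightarrow> bool"
  where "maximal_eigenvalue M \<rho> \<longleftrightarrow>
    (\<exists>x. x \<noteq> 0 \<and> M *v x = \<rho> *\<^sub>R x) \<and>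
    (\<forall>(\<mu>::complex) (z::complex ^ 2). z \<noteq> 0 \<and>
       (\<chi> i j. complex_of_real (M $ i $ j)) *v z = \<mu> *s z \<longrightarrow> cmod \<mu> \<le> \<rho>)"

text \<open>
  \<open>descendants \<xi> A d\<close> counts the descendants, \<open>d\<close> generations later, of the particles \<open>A\<close>;
  \<open>\<xi> d t m\<close> is the offspring vector of the \<open>m\<close>-th particle of type \<open>t\<close> in the \<open>d\<close>-th of these
  generations.
\<close>

fun descendants ::
    "(nat \<Rightarrow> 2 \<Rightarrow> nat \<Rightarrow> 'w \<Rightarrow> nat ^ 2) \<Rightarrow> ('w \<Rightarrow> nat ^ 2) \<Rightarrow> nat \<Rightarrow> 'w \<Rightarrow> nat ^ 2"
  where
    "descendants \<xi> A 0 \<omega> = A \<omega>"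
  | "descendants \<xi> A (Suc d) \<omega> = (\<Sum>t\<in>UNIV. \<Sum>m<descendants \<xi> A d \<omega> $ t. \<xi> d t m \<omega>)"

text \<open>
  \<open>\<xi> 0\<close> governs the reproduction in the process started from \<open>Z0\<close>, and \<open>\<xi> k\<close> for \<open>k \<ge> 1\<close> the
  reproduction of the \<open>k\<close>-th immigration \<open>I k\<close>; generations are counted from the arrival of the
  respective ancestors.  Thus \<open>descendants (\<xi> 0) Z0 n\<close> is Z(n), and
  \<open>descendants (\<xi> k) (I k) (n - k)\<close> is the vector U(n,k) of descendants of \<open>I k\<close> in generation
  \<open>n \<ge> k\<close>.
\<close>

definition gw_immigration ::
    "('w \<Rightarrow> nat ^ 2) \<Rightarrow> (nat \<Rightarrow> nat \<Rightarrow> 2 \<Rightarrow> nat \<Rightarrow> 'w \<Rightarrow> nat ^ 2) \<Rightarrow> (nat \<Rightarrow> 'w \<Rightarrow> nat ^ 2) \<Rightarrow>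
       nat \<Rightarrow> 'w \<Rightarrow> nat ^ 2"
  where "gw_immigration Z0 \<xi> I n \<omega> =
    descendants (\<xi> 0) Z0 n \<omega> + (\<Sum>k=1..n. descendants (\<xi> k) (I k) (n - k) \<omega>)"

text \<open>
  \<open>Pr i\<close> is the probability given that the process starts from one particle of type \<open>i\<close>;
  \<open>p i\<close> is the offspring law of a particle of type \<open>i\<close>, and \<open>q\<close> the law of one immigration.
  Independence of \<open>Z0\<close> from the rest is automatic, as \<open>Z0\<close> is almost surely constant.
\<close>

locale two_type_gw_immigration =
  fixes p :: "2 \<Rightarrow> (nat ^ 2) pmf"
    and q :: "(nat ^ 2) pmf"
    and Pr :: "2 \<Rightarrow> 'w measure"
    and Z0 :: "'w \<Rightarrow> nat ^ 2"
    and \<xi> :: "nat \<Rightarrow> nat \<Rightarrow> 2 \<Rightarrow> nat \<Rightarrow> 'w \<Rightarrow> nat ^ 2"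
    and I :: "nat \<Rightarrow> 'w \<Rightarrow> nat ^ 2"
  assumes prob_space_Pr: "prob_space (Pr i)"
    and measurable_Z0: "Z0 \<in> Pr i \<rightarrow>\<^sub>M count_space UNIV"
    and start: "AE \<omega> in Pr i. Z0 \<omega> = axis i 1"
    and offspring_law: "distr (Pr i) (count_space UNIV) (\<xi> k d t m) = measure_pmf (p t)"
    and immigration_law:
      "k \<ge> 1 \<Longrightarrow> distr (Pr i) (count_space UNIV) (I k) = measure_pmf q"
    and independence:
      "prob_space.indep_vars (Pr i) (\<lambda>_. count_space UNIV)
         (case_sum (\<lambda>(k, d, t, m). \<xi> k d t m) I) (UNIV <+> {1..})"

end

theory Submission
  imports Defs "HOL-Real_Asymp.Real_Asymp"
begin

text \<open>
  Since \<open>\<Lambda>\<close> is chosen after \<open>\<alpha>\<close>, it suffices that both events have, jointly with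
  \<open>Y \<ge> \<alpha>\<close>, probability at most \<open>B * exp (- c * \<rho> ^ n)\<close> with constants depending on
  \<open>\<epsilon>\<close>, \<open>\<alpha>\<close> and \<open>l\<close>; this beats every multiple of \<open>\<rho> powr (n / 3)\<close> in the exponent.

  By the exponential moments, conditioning on generation \<open>n\<close> turns \<open>exp (w \<bullet> X (n + 1))\<close> into
  at most \<open>exp ((M *v w) \<bullet> X n)\<close>, up to a correction of second order in \<open>w\<close>.  Applied to
  multiples of \<open>u\<close> this gives an exponential supermartingale, so that
  \<open>u \<bullet> X m < \<alpha> / 4 * \<rho> ^ m\<close> is very unlikely on \<open>Y \<ge> \<alpha>\<close>.  Once \<open>u \<bullet> X m\<close> is of order
  \<open>\<rho> ^ m\<close>, the first deviation is a Chernoff bound over one generation.  For the second one,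
  \<open>z = l - ((l \<bullet> v) / (1 \<bullet> v)) 1\<close> is orthogonal to \<open>v\<close> and hence an eigenvector for an eigenvalue
  of modulus less than \<open>\<rho>\<close>; over a fixed number of generations \<open>M\<close> contracts \<open>z\<close> relative to
  \<open>u\<close>, and Chernoff's bound applies to \<open>z - \<epsilon> u\<close>.
\<close>

section \<open>Moment generating functions and the mean matrix\<close>

lemma rvec_nth [simp]: "rvec x $ t = real (x $ t)"
  by (simp add: rvec_def)

lemma rvec_add: "rvec (x + y) = rvec x + rvec y"
  by (simp add: vec_eq_iff)

lemma rvec_sum: "rvec (sum f A) = (\<Sum>a\<in>A. rvec (f a))"
  by (simp add: vec_eq_iff)

lemma inner_one_rvec_nonneg: "0 \<le> 1 \<bullet> rvec x"
  by (simp add: inner_vec_def sum_nonneg)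

text \<open>Counts are nonnegative, so \<open>1 \<bullet> rvec x\<close> is the l1 norm of
  \<open>x\<close>. It is the quantity that the exponential moment controls.\<close>

lemma abs_inner_rvec_le: "\<bar>w \<bullet> rvec x\<bar> \<le> norm w * (1 \<bullet> rvec x)"
proof -
  have "\<bar>w \<bullet> rvec x\<bar> \<le> (\<Sum>t\<in>UNIV. \<bar>w $ t * real (x $ t)\<bar>)"
    unfolding inner_vec_def by (simp add: sum_abs)
  also have "\<dots> \<le> (\<Sum>t\<in>UNIV. norm w * real (x $ t))"
    by (intro sum_mono) (simp add: abs_mult mult_right_mono component_le_norm_cart)
  finally show ?thesis
    by (simp add: inner_vec_def sum_distrib_left)
qed

lemma inner_rvec_mono:
  assumes "\<And>t. a $ t \<le> b $ t"
  shows "a \<bullet> rvec x \<le> b \<bullet> rvec x"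
  using assms by (auto simp: inner_vec_def intro!: sum_mono mult_right_mono)

text \<open>A second-order Taylor bound with a crude remainder. For \<open>x \<ge> 0\<close>,
  multiplying \<open>exp x - 1 \<le> x * exp x\<close> by \<open>x\<close> and inserting the result
  into the same inequality gives the claim; for negative \<open>x\<close> the product
  \<open>x * (exp x - 1)\<close> is bounded through \<open>1 - exp x \<le> - x\<close>
  instead.\<close>

lemma exp_le_quadratic: "exp x \<le> 1 + x + x\<^sup>2 * exp \<bar>x\<bar>" for x :: real
proof -
  have *: "exp x - 1 \<le> x * exp x"
  proof -
    have "exp x * (1 - x) \<le> exp x * exp (- x)"
      using exp_ge_add_one_self[of "-x"] by (intro mult_left_mono) auto
    then show ?thesis by (simp add: exp_minus algebra_simps)
  qed
  show ?thesis
  proof (cases "x \<ge> 0")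
    case True
    have "x * (exp x - 1) \<le> x * (x * exp x)"
      using * True by (rule mult_left_mono)
    with * True show ?thesis by (simp add: algebra_simps power2_eq_square)
  next
    case False
    have "(- x) * (1 - exp x) \<le> (- x) * (- x)"
    proof (rule mult_left_mono)
      show "1 - exp x \<le> - x" using exp_ge_add_one_self[of x] by linarith
    qed (use False in simp)
    moreover have "x\<^sup>2 * 1 \<le> x\<^sup>2 * exp \<bar>x\<bar>" by (intro mult_left_mono) auto
    ultimately show ?thesis using * by (simp add: algebra_simps power2_eq_square)
  qed
qed

context
  fixes P :: "(nat ^ 2) pmf" and \<theta> :: real
  assumes \<theta>: "\<theta> > 0"
    and mgf: "integrable P (\<lambda>j. exp (\<theta> * (1 \<bullet> rvec j)))"
begin

lemma integrable_rvec: "integrable P rvec"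
proof (rule Bochner_Integration.integrable_bound)
  show "integrable P (\<lambda>j. 1 / \<theta> * exp (\<theta> * (1 \<bullet> rvec j)))"
    using mgf by simp
  show "AE j in P. norm (rvec j) \<le> norm (1 / \<theta> * exp (\<theta> * (1 \<bullet> rvec j)))"
  proof (rule AE_I2)
    fix j
    have "norm (rvec j) \<le> 1 \<bullet> rvec j"
      using norm_le_l1_cart[of "rvec j"] by (simp add: inner_vec_def)
    also have "\<dots> \<le> 1 / \<theta> * exp (\<theta> * (1 \<bullet> rvec j))"
      using \<theta> exp_ge_add_one_self[of "\<theta> * (1 \<bullet> rvec j)"]
      by (simp add: field_simps del: exp_ge_add_one_self)
    finally show "norm (rvec j) \<le> norm (1 / \<theta> * exp (\<theta> * (1 \<bullet> rvec j)))"
      using \<theta> by simp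
  qed
qed auto

text \<open>Integrate the quadratic bound for \<open>exp\<close> at
  \<open>w \<bullet> rvec j\<close>. Because \<open>norm w\<close> uses up only half of
  \<open>\<theta>\<close>, the remainder is at most \<open>(norm w)\<^sup>2\<close> times a fixed
  integrable function, whose expectation is \<open>C\<close>. Finally
  \<open>1 + x \<le> exp x\<close> brings the bound back into exponential form.\<close>

lemma mgf_quadratic_bound:
  "\<exists>C\<ge>0. \<forall>w. norm w \<le> \<theta> / 2 \<longrightarrow>
     (\<integral>\<^sup>+j. ennreal (exp (w \<bullet> rvec j)) \<partial>P)
       \<le> ennreal (exp (w \<bullet> measure_pmf.expectation P rvec + C * (norm w)\<^sup>2))"
proof -
  let ?N = "\<lambda>j. 1 \<bullet> rvec j"
  let ?G = "\<lambda>j. (?N j)\<^sup>2 * exp (\<theta> / 2 * ?N j)"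
  have G_le: "?G j \<le> 8 / \<theta>\<^sup>2 * exp (\<theta> * ?N j)" for j
  proof -
    have "(\<theta> / 2 * ?N j)\<^sup>2 \<le> 2 * exp (\<theta> / 2 * ?N j)"
    proof -
      have "0 \<le> \<theta> / 2 * ?N j" using \<theta> inner_one_rvec_nonneg[of j] by simp
      with exp_lower_Taylor_quadratic[OF this] show ?thesis by linarith
    qed
    then have "(?N j)\<^sup>2 \<le> 8 / \<theta>\<^sup>2 * exp (\<theta> / 2 * ?N j)"
      using \<theta> by (simp add: field_simps power2_eq_square)
    then have "?G j \<le> 8 / \<theta>\<^sup>2 * exp (\<theta> / 2 * ?N j) * exp (\<theta> / 2 * ?N j)"
      by (intro mult_right_mono) auto
    then show ?thesis by (simp add: mult.assoc flip: exp_add)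
  qed
  have int_G: "integrable P ?G"
  proof (rule Bochner_Integration.integrable_bound)
    show "integrable P (\<lambda>j. 8 / \<theta>\<^sup>2 * exp (\<theta> * ?N j))" using mgf by simp
    show "AE j in P. norm (?G j) \<le> norm (8 / \<theta>\<^sup>2 * exp (\<theta> * ?N j))"
      using G_le by (intro AE_I2) (simp add: abs_mult)
  qed auto
  define C where "C = measure_pmf.expectation P ?G"
  have "C \<ge> 0" unfolding C_def by (intro Bochner_Integration.integral_nonneg) auto
  moreover have "(\<integral>\<^sup>+j. ennreal (exp (w \<bullet> rvec j)) \<partial>P)
       \<le> ennreal (exp (w \<bullet> measure_pmf.expectation P rvec + C * (norm w)\<^sup>2))"
    if w: "norm w \<le> \<theta> / 2" for w
  proof -
    let ?B = "\<lambda>j. 1 + w \<bullet> rvec j + (norm w)\<^sup>2 * ?G j"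
    have le: "exp (w \<bullet> rvec j) \<le> ?B j" for j
    proof -
      have a: "\<bar>w \<bullet> rvec j\<bar> \<le> norm w * ?N j" by (rule abs_inner_rvec_le)
      have "(w \<bullet> rvec j)\<^sup>2 \<le> (norm w * ?N j)\<^sup>2"
        using a by (metis abs_ge_zero power2_abs power_mono)
      moreover have "exp \<bar>w \<bullet> rvec j\<bar> \<le> exp (\<theta> / 2 * ?N j)"
        using a mult_right_mono[OF w inner_one_rvec_nonneg, of j] by simp
      ultimately have "(w \<bullet> rvec j)\<^sup>2 * exp \<bar>w \<bullet> rvec j\<bar> \<le> (norm w * ?N j)\<^sup>2 * exp (\<theta> / 2 * ?N j)"
        by (intro mult_mono) auto
      then show ?thesis
        using exp_le_quadratic[of "w \<bullet> rvec j"] by (simp add: power_mult_distrib mult.assoc)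
    qed
    have intw: "integrable P (\<lambda>j. w \<bullet> rvec j)"
      using integrable_rvec by simp
    have int: "integrable P ?B"
      using int_G intw by simp
    have "(\<integral>\<^sup>+j. ennreal (exp (w \<bullet> rvec j)) \<partial>P) \<le> (\<integral>\<^sup>+j. ennreal (?B j) \<partial>P)"
      using le by (intro nn_integral_mono ennreal_leI)
    also have "\<dots> = ennreal (measure_pmf.expectation P ?B)"
      using int by (rule nn_integral_eq_integral) (use le exp_ge_zero order_trans in blast)
    also have "measure_pmf.expectation P ?B = 1 + w \<bullet> measure_pmf.expectation P rvec + C * (norm w)\<^sup>2"
      using int_G intw integrable_rvec by (simp add: C_def mult.commute)
    also have "\<dots> \<le> exp (w \<bullet> measure_pmf.expectation P rvec + C * (norm w)\<^sup>2)"
      using exp_ge_add_one_self[of "w \<bullet> measure_pmf.expectation P rvec + C * (norm w)\<^sup>2"]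
      by (simp add: algebra_simps)
    finally show ?thesis by (simp add: ennreal_leI)
  qed
  ultimately show ?thesis by blast
qed

end

section \<open>The mean matrix as an expectation\<close>

text \<open>For \<open>\<bar>s\<bar> \<le> 1\<close> the series is dominated by the probabilities
  and hence absolutely summable, so the unordered sum in the generating function agrees with a
  Bochner expectation.\<close>

lemma offspring_gf_line:
  assumes "\<bar>s\<bar> \<le> 1"
  shows "offspring_gf p (\<chi> t. if t = j then s else 1) $ i
    = measure_pmf.expectation (p i) (\<lambda>x. s ^ (x $ j))"
proof -
  have prod: "(\<Prod>t\<in>UNIV. (if t = j then s else 1) ^ (x $ t)) = s ^ (x $ j)" for x :: "nat ^ 2"
  proof -
    have "(\<Prod>t\<in>UNIV. (if t = j then s else 1) ^ (x $ t)) = (\<Prod>t\<in>UNIV. if t = j then s ^ (x $ t) else 1)"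
      by (rule prod.cong) auto
    then show ?thesis by simp
  qed
  have abs: "Infinite_Set_Sum.abs_summable_on (\<lambda>x. pmf (p i) x * s ^ (x $ j)) UNIV"
  proof (rule abs_summable_on_comparison_test)
    show "Infinite_Set_Sum.abs_summable_on (\<lambda>x. pmf (p i) x) UNIV"
      by (simp add: pmf_abs_summable)
    show "norm (pmf (p i) x * s ^ (x $ j)) \<le> norm (pmf (p i) x)" for x
      using assms by (simp add: abs_mult power_abs mult_left_le power_le_one)
  qed
  have "offspring_gf p (\<chi> t. if t = j then s else 1) $ i = (\<Sum>\<^sub>\<infinity>x. pmf (p i) x * s ^ (x $ j))"
    by (simp add: offspring_gf_def prod)
  also have "\<dots> = (\<Sum>\<^sub>ax. pmf (p i) x * s ^ (x $ j))"
    using abs by (simp add: infsetsum_infsum)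
  also have "\<dots> = measure_pmf.expectation (p i) (\<lambda>x. s ^ (x $ j))"
    by (simp add: pmf_expectation_eq_infsetsum)
  finally show ?thesis .
qed

text \<open>Along a sequence increasing to 1, the difference quotient of the generating function is
  the expectation of the geometric sum of \<open>s n ^ k\<close> over \<open>k < x $ j\<close>. This
  sum is dominated by \<open>x $ j\<close> and tends to it, so dominated convergence identifies the
  one-sided derivative with the mean.\<close>

lemma mean_matrix_row:
  assumes mean: "is_mean_matrix p M" and int: "integrable (p i) rvec"
  shows "M $ i = measure_pmf.expectation (p i) rvec"
proof -
  have "M $ i $ j = measure_pmf.expectation (p i) rvec $ j" for j
  proof -
    let ?g = "\<lambda>s. offspring_gf p (\<chi> t. if t = j then s else 1) $ i"
    define s where "s n = 1 + - inverse (real (Suc n))" for n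
    have s: "s n < 1" "\<bar>s n\<bar> \<le> 1" "0 \<le> s n" for n by (auto simp: s_def field_simps)
    have s_lim: "s \<longlonglongrightarrow> 1"
      unfolding s_def by (rule LIMSEQ_inverse_real_of_nat_add_minus)
    have "filterlim s (at_left 1) sequentially"
      unfolding filterlim_at using s_lim s(1) by (simp add: less_imp_neq[OF s(1)])
    moreover have "((\<lambda>s. (?g s - ?g 1) / (s - 1)) \<longlongrightarrow> M $ i $ j) (at_left 1)"
      using mean[unfolded is_mean_matrix_def has_field_derivative_iff] by blast
    ultimately have "(\<lambda>n. (?g (s n) - ?g 1) / (s n - 1)) \<longlonglongrightarrow> M $ i $ j"
      by (rule filterlim_compose[rotated])
    moreover have "(?g (s n) - ?g 1) / (s n - 1)
        = measure_pmf.expectation (p i) (\<lambda>x. \<Sum>k<x $ j. s n ^ k)" for n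
    proof -
      have intp: "integrable (p i) (\<lambda>x. s n ^ (x $ j))"
        by (rule measure_pmf.integrable_const_bound[where B = 1])
           (use s in \<open>auto simp: power_abs power_le_one\<close>)
      have "?g (s n) - ?g 1 = measure_pmf.expectation (p i) (\<lambda>x. s n ^ (x $ j) - 1)"
        using s intp by (subst (1 2) offspring_gf_line) auto
      moreover have "s n ^ (x $ j) - 1 = (\<Sum>k<x $ j. s n ^ k) * (s n - 1)" for x :: "nat ^ 2"
        using power_diff_1_eq[of "s n" "x $ j"] by (simp add: mult.commute)
      ultimately show ?thesis using s(1)[of n] by simp
    qed
    ultimately have "(\<lambda>n. measure_pmf.expectation (p i) (\<lambda>x. \<Sum>k<x $ j. s n ^ k)) \<longlonglongrightarrow> M $ i $ j"
      by simp
    moreover have "(\<lambda>n. measure_pmf.expectation (p i) (\<lambda>x. \<Sum>k<x $ j. s n ^ k))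
        \<longlonglongrightarrow> measure_pmf.expectation (p i) (\<lambda>x. \<Sum>k<x $ j. 1 ^ k)"
    proof (rule integral_dominated_convergence[where w = "\<lambda>x. rvec x $ j"])
      show "integrable (p i) (\<lambda>x. rvec x $ j)"
        using integrable_inner_left[OF int, of "axis j 1"] by (simp add: inner_axis)
      show "AE x in p i. (\<lambda>n. \<Sum>k<x $ j. s n ^ k) \<longlonglongrightarrow> (\<Sum>k<x $ j. 1 ^ k)"
        using s_lim by (intro AE_I2 tendsto_sum tendsto_power)
      show "AE x in p i. norm (\<Sum>k<x $ j. s n ^ k) \<le> rvec x $ j" for n
      proof (rule AE_I2)
        fix x
        have "norm (\<Sum>k<x $ j. s n ^ k) \<le> of_nat (card {..<x $ j}) * 1"
          by (rule sum_norm_bound) (use s in \<open>auto simp: power_abs power_le_one\<close>)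
        then show "norm (\<Sum>k<x $ j. s n ^ k) \<le> rvec x $ j" by simp
      qed
    qed auto
    ultimately have "M $ i $ j = measure_pmf.expectation (p i) (\<lambda>x. rvec x $ j)"
      by (simp add: LIMSEQ_unique)
    also have "\<dots> = measure_pmf.expectation (p i) (\<lambda>x. rvec x \<bullet> axis j 1)"
      by (simp add: inner_axis)
    also have "\<dots> = measure_pmf.expectation (p i) rvec $ j"
      using int by (subst integral_inner_left) (simp_all add: inner_axis)
    finally show ?thesis .
  qed
  then show ?thesis by (simp add: vec_eq_iff)
qed

section \<open>Conditioning on one generation\<close>

text \<open>As \<open>f\<close> takes countably many values, it may be frozen at each of them; then
  only \<open>g\<close> remains to be composed with a map on a discrete space.\<close>

lemma measurable_binop_count_space:
  fixes f :: "'a \<Rightarrow> 'b :: countable" and g :: "'a \<Rightarrow> 'c :: countable"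
  assumes f: "f \<in> N \<rightarrow>\<^sub>M count_space UNIV" and g: "g \<in> N \<rightarrow>\<^sub>M count_space UNIV"
  shows "(\<lambda>x. F (f x) (g x)) \<in> N \<rightarrow>\<^sub>M count_space UNIV"
  by (rule measurable_compose_countable[OF _ f, where f = "\<lambda>a x. F a (g x)"])
     (rule measurable_compose[OF g], simp)

lemma measurable_sum_count_space:
  fixes f :: "'i \<Rightarrow> 'a \<Rightarrow> 'b :: {countable, comm_monoid_add}"
  assumes "\<And>i. i \<in> S \<Longrightarrow> f i \<in> N \<rightarrow>\<^sub>M count_space UNIV"
  shows "(\<lambda>x. \<Sum>i\<in>S. f i x) \<in> N \<rightarrow>\<^sub>M count_space UNIV"
  using assms
  by (induction S rule: infinite_finite_induct) (simp_all add: measurable_binop_count_space)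

lemma measurable_map_count_space:
  fixes f :: "'i \<Rightarrow> 'a \<Rightarrow> 'b :: countable"
  assumes "\<And>i. i \<in> set S \<Longrightarrow> f i \<in> N \<rightarrow>\<^sub>M count_space UNIV"
  shows "(\<lambda>x. map (\<lambda>i. f i x) S) \<in> N \<rightarrow>\<^sub>M count_space UNIV"
  using assms by (induction S) (simp_all add: measurable_binop_count_space)

lemma descendants_cong:
  assumes "A \<omega> = A' \<omega>'" and "\<And>e t m. e < d \<Longrightarrow> \<xi> e t m \<omega> = \<xi>' e t m \<omega>'"
  shows "descendants \<xi> A d \<omega> = descendants \<xi>' A' d \<omega>'"
  using assms by (induction d) simp_all

lemma measurable_descendants:
  assumes "A \<in> N \<rightarrow>\<^sub>M count_space UNIV"
    and "\<And>e t m. e < d \<Longrightarrow> \<xi> e t m \<in> N \<rightarrow>\<^sub>M count_space UNIV"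
  shows "descendants \<xi> A d \<in> N \<rightarrow>\<^sub>M count_space UNIV"
  using assms(2)
proof (induction d)
  case 0
  have "descendants \<xi> A 0 = A" by (rule ext) simp
  then show ?case using assms(1) by simp
next
  case (Suc d)
  \<comment> \<open>The range of summation is random, but it is governed by a countably valued
    vector and may be fixed at each of its values.\<close>
  have "(\<lambda>\<omega>. \<Sum>t\<in>UNIV. \<Sum>m<descendants \<xi> A d \<omega> $ t. \<xi> d t m \<omega>) \<in> N \<rightarrow>\<^sub>M count_space UNIV"
    using Suc
    by (intro measurable_compose_countable[where g = "descendants \<xi> A d"
          and f = "\<lambda>x \<omega>. \<Sum>t\<in>UNIV. \<Sum>m<x $ t. \<xi> d t m \<omega>"] measurable_sum_count_space) auto
  moreover have "descendants \<xi> A (Suc d) = (\<lambda>\<omega>. \<Sum>t\<in>UNIV. \<Sum>m<descendants \<xi> A d \<omega> $ t. \<xi> d t m \<omega>)"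
    by (rule ext) simp
  ultimately show ?case by simp
qed

section \<open>The process as a function of independent coordinates\<close>

text \<open>
  A sample point is recorded by its coordinates \<open>x\<close>: \<open>x (Inl (k, d, t, m))\<close> is the value of
  \<open>\<xi> k d t m\<close> and \<open>x (Inr k)\<close> that of \<open>I k\<close>.
\<close>

type_synonym coord = "nat \<times> nat \<times> 2 \<times> nat + nat"

definition lineage :: "2 \<Rightarrow> nat \<Rightarrow> nat \<Rightarrow> (coord \<Rightarrow> nat ^ 2) \<Rightarrow> nat ^ 2"
  where "lineage i n k x = descendants (\<lambda>d t m x. x (Inl (k, d, t, m)))
    (\<lambda>x. if k = 0 then axis i 1 else x (Inr k)) (n - k) x"

definition population :: "2 \<Rightarrow> nat \<Rightarrow> (coord \<Rightarrow> nat ^ 2) \<Rightarrow> nat ^ 2"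
  where "population i n x = (\<Sum>k\<le>n. lineage i n k x)"

text \<open>A particle of line \<open>k\<close> that lives \<open>d\<close> generations after the
  arrival belongs to absolute generation \<open>k + d\<close>. Thus \<open>past n\<close> collects
  what determines generations up to \<open>n\<close>, and \<open>present n\<close> what creates
  generation \<open>n + 1\<close> from it.\<close>

definition past :: "nat \<Rightarrow> coord set"
  where "past n = {Inl (k, d, t, m) | k d t m. k + d < n} \<union> Inr ` {1..n}"

definition present :: "nat \<Rightarrow> coord set"
  where "present n = {Inl (k, d, t, m) | k d t m. k + d = n} \<union> {Inr (Suc n)}"

lemma past_iff [simp]:
  "Inl (k, d, t, m) \<in> past n \<longleftrightarrow> k + d < n" "Inr k \<in> past n \<longleftrightarrow> 1 \<le> k \<and> k \<le> n"
  by (auto simp: past_def)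

lemma present_iff [simp]:
  "Inl (k, d, t, m) \<in> present n \<longleftrightarrow> k + d = n" "Inr k \<in> present n \<longleftrightarrow> k = Suc n"
  by (auto simp: present_def)

lemma lineage_cong:
  assumes "k \<le> n" "n \<le> n'" and "\<And>j. j \<in> past n' \<Longrightarrow> x j = y j"
  shows "lineage i n k x = lineage i n k y"
  unfolding lineage_def
  by (rule descendants_cong) (use assms in auto)

lemma population_cong:
  assumes "n \<le> n'" and "\<And>j. j \<in> past n' \<Longrightarrow> x j = y j"
  shows "population i n x = population i n y"
  unfolding population_def using assms by (auto intro!: sum.cong lineage_cong[where n' = n'])

lemma measurable_lineage:
  assumes "k \<le> n" "n \<le> n'"
  shows "lineage i n k \<in> PiM (past n') (\<lambda>_. count_space UNIV) \<rightarrow>\<^sub>M count_space UNIV"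
  unfolding lineage_def
proof (rule measurable_descendants)
  show "(\<lambda>x. if k = 0 then axis i 1 else x (Inr k))
      \<in> PiM (past n') (\<lambda>_. count_space UNIV) \<rightarrow>\<^sub>M count_space UNIV"
    using assms by (cases "k = 0") (auto intro!: measurable_component_singleton)
qed (use assms in \<open>auto intro!: measurable_component_singleton\<close>)

lemma measurable_population:
  assumes "n \<le> n'"
  shows "population i n \<in> PiM (past n') (\<lambda>_. count_space UNIV) \<rightarrow>\<^sub>M count_space UNIV"
  unfolding population_def using assms
  by (intro measurable_sum_count_space measurable_lineage) auto

text \<open>This writes generation \<open>n + 1\<close> in terms of the line sizes in generation
  \<open>n\<close>, which the past determines, and of coordinates from
  \<open>present n\<close>.\<close>

lemma population_Suc:
  "population i (Suc n) x =
     (\<Sum>k\<le>n. \<Sum>t\<in>UNIV. \<Sum>m<lineage i n k x $ t. x (Inl (k, n - k, t, m))) + x (Inr (Suc n))"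
proof -
  have "lineage i (Suc n) (Suc n) x = x (Inr (Suc n))"
    by (simp add: lineage_def)
  moreover have "lineage i (Suc n) k x =
      (\<Sum>t\<in>UNIV. \<Sum>m<lineage i n k x $ t. x (Inl (k, n - k, t, m)))" if "k \<le> n" for k
    using that by (simp add: lineage_def Suc_diff_le)
  ultimately show ?thesis by (simp add: population_def)
qed

section \<open>The exponential transform of one generation\<close>

context prob_space
begin

context
  fixes V :: "coord \<Rightarrow> 'a \<Rightarrow> nat ^ 2" and p :: "2 \<Rightarrow> (nat ^ 2) pmf" and q :: "(nat ^ 2) pmf"
  assumes indep: "indep_vars (\<lambda>_. count_space UNIV) V (UNIV <+> {1..})"
    and offspring: "\<And>k d t m. distr M (count_space UNIV) (V (Inl (k, d, t, m))) = measure_pmf (p t)"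
    and immigration: "\<And>k. k \<ge> 1 \<Longrightarrow> distr M (count_space UNIV) (V (Inr k)) = measure_pmf q"
begin

lemma measurable_coords: "j \<in> UNIV <+> {1..} \<Longrightarrow> V j \<in> M \<rightarrow>\<^sub>M count_space UNIV"
  using indep by (auto simp: indep_vars_def)

lemma measurable_restrict_coords:
  assumes "A \<subseteq> UNIV <+> {1..}"
  shows "(\<lambda>\<omega>. restrict (\<lambda>j. V j \<omega>) A) \<in> M \<rightarrow>\<^sub>M PiM A (\<lambda>_. count_space UNIV)"
  using assms measurable_coords by (intro measurable_restrict) blast

lemma past_subset: "past n \<subseteq> UNIV <+> {1..}"
  and present_subset: "present n \<subseteq> UNIV <+> {1..}"
  and past_present_disjoint: "past n \<inter> present n = {}"
  by (auto simp: past_def present_def)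

lemma measurable_population_process:
  "(\<lambda>\<omega>. population i n (\<lambda>j. V j \<omega>)) \<in> M \<rightarrow>\<^sub>M count_space UNIV"
proof -
  have "(\<lambda>\<omega>. population i n (restrict (\<lambda>j. V j \<omega>) (past n))) \<in> M \<rightarrow>\<^sub>M count_space UNIV"
    by (rule measurable_compose[OF measurable_restrict_coords measurable_population])
       (use past_subset in auto)
  moreover have "population i n (restrict (\<lambda>j. V j \<omega>) (past n)) = population i n (\<lambda>j. V j \<omega>)" for \<omega>
    by (rule population_cong) auto
  ultimately show ?thesis by simp
qed

text \<open>For frozen line sizes \<open>x k\<close> the next generation is a finite sum of
  independent vectors, so the integral of the exponential is a product. Each particle of type
  \<open>t\<close> contributes a factor at most \<open>exp (a $ t)\<close> and the immigration one
  at most \<open>exp b\<close>; the exponents add up to an inner product with the total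
  population.\<close>

lemma nn_integral_exp_generation:
  assumes "\<And>t. (\<integral>\<^sup>+j. ennreal (exp (w \<bullet> rvec j)) \<partial>p t) \<le> ennreal (exp (a $ t))"
    and "(\<integral>\<^sup>+j. ennreal (exp (w \<bullet> rvec j)) \<partial>q) \<le> ennreal (exp b)"
  shows "(\<integral>\<^sup>+\<omega>. ennreal (exp (w \<bullet> rvec
      ((\<Sum>k\<le>n. \<Sum>t\<in>UNIV. \<Sum>m<(x k :: nat ^ 2) $ t. V (Inl (k, n - k, t, m)) \<omega>) + V (Inr (Suc n)) \<omega>))) \<partial>M)
    \<le> ennreal (exp (a \<bullet> rvec (\<Sum>k\<le>n. x k) + b))"
proof -
  let ?E = "\<lambda>j \<omega>. ennreal (exp (w \<bullet> rvec (V j \<omega>)))"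
  \<comment> \<open>\<open>Q\<close> lists the living particles by line, type and number,
    \<open>g\<close> sends each to the coordinate holding its offspring, and \<open>K\<close> adds
    the coordinate of the new immigration.\<close>
  define Q where "Q = (SIGMA k:{..n}. SIGMA t:UNIV. {..<x k $ t})"
  define g :: "nat \<times> 2 \<times> nat \<Rightarrow> coord" where "g = (\<lambda>(k, t, m). Inl (k, n - k, t, m))"
  have inj: "inj_on g Q" by (auto simp: inj_on_def g_def)
  have finQ: "finite Q" by (auto simp: Q_def)
  have notin: "Inr (Suc n) \<notin> g ` Q" by (auto simp: g_def)
  define K where "K = insert (Inr (Suc n)) (g ` Q)"
  have K: "finite K" "K \<subseteq> UNIV <+> {1..}"
    using finQ by (auto simp: K_def g_def)
  have sumQ: "(\<Sum>k\<le>n. \<Sum>t\<in>UNIV. \<Sum>m<x k $ t. F k t m) = (\<Sum>z\<in>Q. case z of (k, t, m) \<Rightarrow> F k t m)"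
    for F :: "nat \<Rightarrow> 2 \<Rightarrow> nat \<Rightarrow> 'z :: comm_monoid_add"
    unfolding Q_def by (subst sum.Sigma; simp)+
  have "w \<bullet> rvec ((\<Sum>k\<le>n. \<Sum>t\<in>UNIV. \<Sum>m<x k $ t. V (Inl (k, n - k, t, m)) \<omega>) + V (Inr (Suc n)) \<omega>)
      = (\<Sum>j\<in>K. w \<bullet> rvec (V j \<omega>))" for \<omega>
  proof -
    have "(\<Sum>j\<in>K. w \<bullet> rvec (V j \<omega>)) =
        w \<bullet> rvec (V (Inr (Suc n)) \<omega>) + (\<Sum>z\<in>Q. w \<bullet> rvec (V (g z) \<omega>))"
      unfolding K_def using notin finQ by (simp add: sum.reindex[OF inj])
    then show ?thesis
      unfolding sumQ by (simp add: rvec_add rvec_sum inner_add_right inner_sum_right g_def case_prod_beta)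
  qed
  then have "(\<integral>\<^sup>+\<omega>. ennreal (exp (w \<bullet> rvec
      ((\<Sum>k\<le>n. \<Sum>t\<in>UNIV. \<Sum>m<x k $ t. V (Inl (k, n - k, t, m)) \<omega>) + V (Inr (Suc n)) \<omega>))) \<partial>M)
      = (\<integral>\<^sup>+\<omega>. (\<Prod>j\<in>K. ?E j \<omega>) \<partial>M)"
    using K by (simp add: exp_sum prod_ennreal)
  also have "\<dots> = (\<Prod>j\<in>K. \<integral>\<^sup>+\<omega>. ?E j \<omega> \<partial>M)"
    by (rule indep_vars_nn_integral[OF K(1) indep_vars_compose2[OF indep_vars_subset[OF indep K(2)]]]) auto
  also have "\<dots> = (\<integral>\<^sup>+\<omega>. ?E (Inr (Suc n)) \<omega> \<partial>M) * (\<Prod>z\<in>Q. \<integral>\<^sup>+\<omega>. ?E (g z) \<omega> \<partial>M)"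
    unfolding K_def using notin finQ inj by (simp add: prod.reindex)
  also have "\<dots> \<le> ennreal (exp b) * (\<Prod>z\<in>Q. ennreal (exp (a $ fst (snd z))))"
  proof (intro mult_mono prod_mono_ennreal)
    have law: "(\<integral>\<^sup>+\<omega>. ?E j \<omega> \<partial>M) = (\<integral>\<^sup>+y. ennreal (exp (w \<bullet> rvec y)) \<partial>measure_pmf r)"
      if "j \<in> UNIV <+> {1..}" "distr M (count_space UNIV) (V j) = measure_pmf r" for j r
      unfolding that(2)[symmetric] using measurable_coords[OF that(1)] by (subst nn_integral_distr) auto
    show "(\<integral>\<^sup>+\<omega>. ?E (Inr (Suc n)) \<omega> \<partial>M) \<le> ennreal (exp b)"
      using assms(2) by (subst law[OF _ immigration]) auto
    show "(\<integral>\<^sup>+\<omega>. ?E (g z) \<omega> \<partial>M) \<le> ennreal (exp (a $ fst (snd z)))" if "z \<in> Q" for z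
    proof (cases z)
      case (fields k t m)
      then show ?thesis
        using assms(1)[of t] law[OF _ offspring, of k "n - k" t m] by (simp add: g_def InlI)
    qed
  qed auto
  also have "\<dots> = ennreal (exp (b + (\<Sum>z\<in>Q. a $ fst (snd z))))"
    using finQ by (simp add: prod_ennreal exp_add exp_sum prod_nonneg flip: ennreal_mult)
  also have "(\<Sum>z\<in>Q. a $ fst (snd z)) = (\<Sum>k\<le>n. \<Sum>t\<in>UNIV. \<Sum>m<x k $ t. a $ t)"
    unfolding sumQ by (simp add: case_prod_beta)
  also have "\<dots> = a \<bullet> rvec (\<Sum>k\<le>n. x k)"
    unfolding rvec_sum inner_sum_right by (simp add: inner_vec_def mult.commute)
  finally show ?thesis by (simp add: add.commute)
qed

text \<open>
  The history up to generation \<open>n\<close> takes countably many values and is independent of the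
  variables that create generation \<open>n + 1\<close>, so the latter are integrated out first.
\<close>

lemma nn_integral_exp_step:
  assumes bounds: "\<And>t. (\<integral>\<^sup>+j. ennreal (exp (w \<bullet> rvec j)) \<partial>p t) \<le> ennreal (exp (a $ t))"
      "(\<integral>\<^sup>+j. ennreal (exp (w \<bullet> rvec j)) \<partial>q) \<le> ennreal (exp b)"
    and mn: "m \<le> n"
  shows "(\<integral>\<^sup>+\<omega>. h (population i m (\<lambda>j. V j \<omega>)) *
        ennreal (exp (w \<bullet> rvec (population i (Suc n) (\<lambda>j. V j \<omega>)))) \<partial>M)
    \<le> (\<integral>\<^sup>+\<omega>. h (population i m (\<lambda>j. V j \<omega>)) *
        ennreal (exp (a \<bullet> rvec (population i n (\<lambda>j. V j \<omega>)) + b)) \<partial>M)"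
proof -
  let ?C = "count_space UNIV :: ((nat ^ 2) \<times> (nat ^ 2) list) measure"
  let ?A = "PiM (past n) (\<lambda>_. count_space (UNIV :: (nat ^ 2) set))"
  let ?B = "PiM (present n) (\<lambda>_. count_space (UNIV :: (nat ^ 2) set))"
  \<comment> \<open>The sizes of all lines are kept, not merely their sum, because every line draws
    its offspring from its own coordinates. The record still has a countable type, which makes
    \<open>G\<close> measurable for arbitrary \<open>h\<close>.\<close>
  define H where "H x = (population i m x, map (\<lambda>k. lineage i n k x) [0..<Suc n])" for x
  define P where "P \<omega> = H (\<lambda>j. V j \<omega>)" for \<omega>
  define R where "R \<omega> = restrict (\<lambda>j. V j \<omega>) (present n)" for \<omega>
  define S where "S xs y =
    (\<Sum>k\<le>n. \<Sum>t\<in>UNIV. \<Sum>m<(xs ! k) $ t. y (Inl (k, n - k, t, m))) + y (Inr (Suc n))"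
    for xs :: "(nat ^ 2) list" and y :: "coord \<Rightarrow> nat ^ 2"
  define G where "G z = h (fst (fst z)) * ennreal (exp (w \<bullet> rvec (S (snd (fst z)) (snd z))))"
    for z :: "((nat ^ 2) \<times> (nat ^ 2) list) \<times> (coord \<Rightarrow> nat ^ 2)"
  have H: "H \<in> ?A \<rightarrow>\<^sub>M ?C"
    unfolding H_def using mn
    by (intro measurable_binop_count_space[where F = Pair] measurable_map_count_space
        measurable_population measurable_lineage) auto
  let ?R = "\<lambda>\<omega>. restrict (\<lambda>j. V j \<omega>) (past n)"
  have "indep_var ?A ?R ?B R"
    unfolding R_def
    by (rule indep_var_restrict[OF indep past_present_disjoint past_subset present_subset])
  then have P: "?R \<in> M \<rightarrow>\<^sub>M ?A" and R: "R \<in> M \<rightarrow>\<^sub>M ?B"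
    and joint: "distr M ?A ?R \<Otimes>\<^sub>M distr M ?B R = distr M (?A \<Otimes>\<^sub>M ?B) (\<lambda>\<omega>. (?R \<omega>, R \<omega>))"
    by (auto simp: indep_var_distribution_eq)
  have H_R: "H (?R \<omega>) = P \<omega>" for \<omega>
    unfolding P_def H_def
    by (auto intro!: population_cong[OF mn] lineage_cong[OF _ order_refl] simp del: upt_Suc)
  have S: "(\<lambda>y. S xs y) \<in> ?B \<rightarrow>\<^sub>M count_space UNIV" for xs
    unfolding S_def
    by (intro measurable_binop_count_space[where F = plus] measurable_sum_count_space
        measurable_component_singleton) (auto simp: present_def)
  have ES: "(\<lambda>y. exp (w \<bullet> rvec (S xs y))) \<in> borel_measurable ?B" for xs
    by (rule measurable_compose[OF S]) simp
  have G: "G \<in> borel_measurable (?C \<Otimes>\<^sub>M ?B)"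
    by (rule measurable_pair_measure_countable1)
       (auto simp: G_def intro!: borel_measurable_times_ennreal measurable_compose[OF S])
  have GH: "(\<lambda>z. G (H (fst z), snd z)) \<in> borel_measurable (?A \<Otimes>\<^sub>M ?B)"
    using H by (intro measurable_compose[OF _ G] measurable_Pair measurable_compose[OF _ H]) auto
  interpret RB: prob_space "distr M ?B R" using R by (rule prob_space_distr)
  have S_V: "S xs (R \<omega>) = S xs (\<lambda>j. V j \<omega>)" for xs \<omega>
    unfolding S_def R_def by (intro arg_cong2[where f = plus] sum.cong) (auto simp: present_def)
  have nth: "map (\<lambda>k. lineage i n k x) [0..<Suc n] ! k = lineage i n k x" if "k \<le> n" for k x
    using that by (simp del: upt_Suc)
  have "S (snd (P \<omega>)) (\<lambda>j. V j \<omega>) = population i (Suc n) (\<lambda>j. V j \<omega>)" for \<omega>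
    unfolding population_Suc S_def P_def H_def snd_conv
    by (intro arg_cong2[where f = plus] sum.cong) (simp_all add: nth del: upt_Suc)
  then have "(\<integral>\<^sup>+\<omega>. h (population i m (\<lambda>j. V j \<omega>)) *
        ennreal (exp (w \<bullet> rvec (population i (Suc n) (\<lambda>j. V j \<omega>)))) \<partial>M) = (\<integral>\<^sup>+\<omega>. G (P \<omega>, R \<omega>) \<partial>M)"
    by (simp add: G_def S_V) (simp add: P_def H_def)
  also have "\<dots> = (\<integral>\<^sup>+z. G (H (fst z), snd z) \<partial>distr M (?A \<Otimes>\<^sub>M ?B) (\<lambda>\<omega>. (?R \<omega>, R \<omega>)))"
    using P R GH by (subst nn_integral_distr) (auto simp: H_R)
  also have "\<dots> = (\<integral>\<^sup>+x. \<integral>\<^sup>+y. G (H x, y) \<partial>distr M ?B R \<partial>distr M ?A ?R)"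
    unfolding joint[symmetric] using GH by (subst RB.nn_integral_fst[symmetric]) auto
  also have "\<dots> = (\<integral>\<^sup>+\<omega>. \<integral>\<^sup>+y. G (P \<omega>, y) \<partial>distr M ?B R \<partial>M)"
    using P RB.borel_measurable_nn_integral_fst[of "\<lambda>z. G (H (fst z), snd z)" ?A] GH
    by (subst nn_integral_distr) (auto simp: H_R)
  also have "\<dots> \<le> (\<integral>\<^sup>+\<omega>. h (population i m (\<lambda>j. V j \<omega>)) *
        ennreal (exp (a \<bullet> rvec (population i n (\<lambda>j. V j \<omega>)) + b)) \<partial>M)"
  proof (rule nn_integral_mono)
    fix \<omega>
    let ?x = "\<lambda>k. lineage i n k (\<lambda>j. V j \<omega>)"
    have "(\<integral>\<^sup>+y. G (P \<omega>, y) \<partial>distr M ?B R)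
        = h (fst (P \<omega>)) * (\<integral>\<^sup>+y. ennreal (exp (w \<bullet> rvec (S (snd (P \<omega>)) y))) \<partial>distr M ?B R)"
      unfolding G_def using ES R by (simp add: nn_integral_cmult)
    also have "(\<integral>\<^sup>+y. ennreal (exp (w \<bullet> rvec (S (snd (P \<omega>)) y))) \<partial>distr M ?B R)
        = (\<integral>\<^sup>+\<omega>'. ennreal (exp (w \<bullet> rvec (S (snd (P \<omega>)) (\<lambda>j. V j \<omega>')))) \<partial>M)"
      using R ES by (subst nn_integral_distr) (auto simp: S_V)
    also have "\<dots> = (\<integral>\<^sup>+\<omega>'. ennreal (exp (w \<bullet> rvec
       ((\<Sum>k\<le>n. \<Sum>t\<in>UNIV. \<Sum>m<?x k $ t. V (Inl (k, n - k, t, m)) \<omega>') + V (Inr (Suc n)) \<omega>'))) \<partial>M)"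
      unfolding S_def P_def H_def snd_conv
      by (intro nn_integral_cong arg_cong[where f = "\<lambda>z. ennreal (exp (w \<bullet> rvec z))"]
          arg_cong2[where f = plus] sum.cong) (simp_all add: nth del: upt_Suc)
    also have "\<dots> \<le> ennreal (exp (a \<bullet> rvec (population i n (\<lambda>j. V j \<omega>)) + b))"
      unfolding population_def by (rule nn_integral_exp_generation[OF bounds])
    finally show "(\<integral>\<^sup>+y. G (P \<omega>, y) \<partial>distr M ?B R) \<le> h (population i m (\<lambda>j. V j \<omega>)) *
        ennreal (exp (a \<bullet> rvec (population i n (\<lambda>j. V j \<omega>)) + b))"
      by (simp add: P_def H_def mult_left_mono)
  qed
  finally show ?thesis .
qed

end

end

section \<open>Exponential bounds for the process\<close>

text \<open>
  All that is needed of the process: one generation multiplies the exponent \<open>w\<close> by the mean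
  matrix, up to an error that is quadratic in \<open>w\<close> (offspring) or bounded (immigration).
\<close>

locale exponential_drift = prob_space N
  for N :: "'w measure" +
  fixes X :: "nat \<Rightarrow> 'w \<Rightarrow> nat ^ 2" and M :: "real ^ 2 ^ 2" and u :: "real ^ 2" and \<rho> C r :: real
  assumes measurable_X: "X n \<in> N \<rightarrow>\<^sub>M count_space UNIV"
    and rho_gt_1: "\<rho> > 1"
    and right_eigenvector: "M *v u = \<rho> *\<^sub>R u"
    and u_pos: "u $ j > 0"
    and u_sum: "u \<bullet> 1 = 1"
    and C_nonneg: "C \<ge> 0"
    and r_pos: "r > 0"
    and drift: "norm w \<le> r \<Longrightarrow> m \<le> n \<Longrightarrow>
      (\<integral>\<^sup>+\<omega>. h (X m \<omega>) * ennreal (exp (w \<bullet> rvec (X (Suc n) \<omega>))) \<partial>N)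
      \<le> (\<integral>\<^sup>+\<omega>. h (X m \<omega>) *
          ennreal (exp ((M *v w + (C * (norm w)\<^sup>2) *\<^sub>R u) \<bullet> rvec (X n \<omega>) + C * norm w)) \<partial>N)"
begin

lemma measurable_inner_X [measurable]: "(\<lambda>\<omega>. w \<bullet> rvec (X n \<omega>)) \<in> borel_measurable N"
  by (rule measurable_compose[OF measurable_X]) simp

lemma u_le_1: "u $ j \<le> 1"
proof -
  have "u $ j \<le> (\<Sum>t\<in>UNIV. u $ t)"
    using u_pos by (intro member_le_sum) (auto simp: less_imp_le)
  then show ?thesis using u_sum by (simp add: inner_vec_def)
qed

lemma norm_u_le_1: "norm u \<le> 1"
proof -
  have "norm u \<le> (\<Sum>t\<in>UNIV. \<bar>u $ t\<bar>)" by (rule norm_le_l1_cart)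
  also have "\<dots> = 1" using u_sum u_pos by (simp add: inner_vec_def less_imp_le)
  finally show ?thesis .
qed

lemma u_rvec_nonneg: "0 \<le> u \<bullet> rvec x"
  using u_pos by (auto simp: inner_vec_def less_imp_le intro!: sum_nonneg)

lemma u_rvec_le: "u \<bullet> rvec x \<le> 1 \<bullet> rvec x"
  using u_le_1 by (intro inner_rvec_mono) simp

text \<open>Markov's inequality in the form used for the Chernoff bounds: \<open>f\<close> dominates
  the indicator of \<open>E\<close>.\<close>

lemma prob_le_of_nn_integral:
  assumes "E \<in> events" and "0 \<le> B" and "\<And>\<omega>. \<omega> \<in> E \<Longrightarrow> 1 \<le> f \<omega>"
    and "(\<integral>\<^sup>+\<omega>. f \<omega> \<partial>N) \<le> ennreal B"
  shows "prob E \<le> B"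
proof -
  have "emeasure N E = (\<integral>\<^sup>+\<omega>. indicator E \<omega> \<partial>N)" using assms(1) by simp
  also have "\<dots> \<le> (\<integral>\<^sup>+\<omega>. f \<omega> \<partial>N)"
    using assms(3) by (intro nn_integral_mono) (auto simp: indicator_def)
  also note assms(4)
  finally show ?thesis using assms(2) by (simp add: emeasure_eq_measure)
qed

lemma nn_integral_le_const:
  assumes "\<And>\<omega>. f \<omega> \<le> ennreal B"
  shows "(\<integral>\<^sup>+\<omega>. f \<omega> \<partial>N) \<le> ennreal B"
proof -
  have "(\<integral>\<^sup>+\<omega>. f \<omega> \<partial>N) \<le> (\<integral>\<^sup>+\<omega>. ennreal B \<partial>N)"
    using assms by (intro nn_integral_mono)
  then show ?thesis by (simp add: emeasure_space_1)
qed

section \<open>An exponential supermartingale and small populations\<close>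

text \<open>
  With \<open>t = \<rho> powr -d\<close> the exponents \<open>\<theta> d = a * (t + t\<^sup>2)\<close> satisfy
  \<open>\<theta> d \<ge> \<rho> * \<theta> (d + 1) + C * (\<theta> (d + 1))\<^sup>2\<close> for small \<open>a\<close>, which makes
  \<open>exp (\<theta> d * (u \<bullet> X (m + d) + K))\<close> a supermartingale in \<open>d\<close>.
\<close>

lemma exponential_supermartingale:
  "\<exists>a>0. \<exists>K\<ge>0. \<forall>L m d.
    (\<integral>\<^sup>+\<omega>. (if u \<bullet> rvec (X m \<omega>) < L then 1 else 0) *
       ennreal (exp (a * (u \<bullet> rvec (X (m + d) \<omega>)) / \<rho> ^ d)) \<partial>N)
    \<le> ennreal (exp (2 * a * (L + K)))"
proof -
  \<comment> \<open>The first entry of the minimum keeps every exponent, being at most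
    \<open>2 * a\<close>, within the radius \<open>r\<close>; the second yields
    \<open>4 * C * a \<le> \<rho>\<^sup>2 - \<rho>\<close>, needed against the quadratic error. The
    constant \<open>K\<close> below solves \<open>\<rho> * K = K + C\<close> and so absorbs the
    contribution of immigration in each generation.\<close>
  define a where "a = min (r / 2) ((\<rho>\<^sup>2 - \<rho>) / (4 * (C + 1)))"
  define K where "K = C / (\<rho> - 1)"
  define \<tau> where "\<tau> = 1 / \<rho>"
  define \<theta> where "\<theta> d = a * (\<tau> ^ d + (\<tau> ^ d)\<^sup>2)" for d
  have rho2: "\<rho>\<^sup>2 - \<rho> > 0" using rho_gt_1 by (simp add: power2_eq_square)
  have a: "a > 0" "2 * a \<le> r"
    using r_pos C_nonneg rho2 by (auto simp: a_def)
  have a_C: "4 * C * a \<le> \<rho>\<^sup>2 - \<rho>"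
  proof -
    have "a \<le> (\<rho>\<^sup>2 - \<rho>) / (4 * (C + 1))" by (simp add: a_def)
    then have "4 * (C + 1) * a \<le> \<rho>\<^sup>2 - \<rho>" using C_nonneg by (simp add: field_simps)
    then show ?thesis using a by (simp add: algebra_simps)
  qed
  have K: "K \<ge> 0" "\<rho> * K = K + C"
    using rho_gt_1 C_nonneg by (auto simp: K_def field_simps)
  have tau: "0 < \<tau> ^ d" "\<tau> ^ d \<le> 1" for d
    using rho_gt_1 by (auto simp: \<tau>_def power_le_one divide_simps)
  have tau_sq: "(\<tau> ^ d)\<^sup>2 \<le> \<tau> ^ d" for d
    using tau[of d] by (simp add: power2_eq_square mult_left_le)
  have \<theta>: "0 < \<theta> d" "\<theta> d \<le> 2 * a * \<tau> ^ d" "a * \<tau> ^ d \<le> \<theta> d" for d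
  proof -
    show "0 < \<theta> d"
      unfolding \<theta>_def by (rule mult_pos_pos[OF a(1) add_pos_nonneg[OF tau(1)]]) simp
  qed (use a tau_sq[of d] in \<open>auto simp: \<theta>_def\<close>)
  have \<theta>_2a: "\<theta> d \<le> 2 * a" for d
    using \<theta>(2)[of d] mult_left_le[OF tau(2)[of d], of "2 * a"] a by linarith
  \<comment> \<open>The square in \<open>\<theta>\<close> creates room: multiplication by
    \<open>\<rho>\<close> restores the linear term exactly, but the quadratic term only up to the
    factor \<open>\<tau>\<close>. The surplus \<open>a * ?t\<^sup>2 * (1 - \<tau>)\<close> covers
    the error \<open>C * (\<theta> (Suc d))\<^sup>2\<close>.\<close>
  have \<theta>_step: "\<rho> * \<theta> (Suc d) + C * (\<theta> (Suc d))\<^sup>2 \<le> \<theta> d" for d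
  proof -
    let ?t = "\<tau> ^ d"
    have "(\<theta> (Suc d))\<^sup>2 \<le> (2 * a * \<tau> ^ Suc d)\<^sup>2"
      using \<theta>(1,2)[of "Suc d"] by (intro power_mono) auto
    then have "C * (\<theta> (Suc d))\<^sup>2 \<le> C * (2 * a * \<tau> ^ Suc d)\<^sup>2"
      using C_nonneg by (rule mult_left_mono)
    also have "\<dots> = (4 * C * a) * (a * ?t\<^sup>2 * \<tau>\<^sup>2)"
      by (simp add: power2_eq_square)
    also have "\<dots> \<le> (\<rho>\<^sup>2 - \<rho>) * (a * ?t\<^sup>2 * \<tau>\<^sup>2)"
      using a_C a by (intro mult_right_mono) auto
    also have "\<dots> = a * ?t\<^sup>2 - a * ?t\<^sup>2 * \<tau>"
      using rho_gt_1 by (simp add: \<tau>_def field_simps power2_eq_square)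
    finally have "C * (\<theta> (Suc d))\<^sup>2 \<le> a * ?t\<^sup>2 - a * ?t\<^sup>2 * \<tau>" .
    moreover have "\<rho> * \<theta> (Suc d) = a * ?t + a * ?t\<^sup>2 * \<tau>"
      using rho_gt_1 by (simp add: \<theta>_def \<tau>_def field_simps power2_eq_square)
    ultimately show ?thesis by (simp add: \<theta>_def algebra_simps)
  qed
  have main: "(\<integral>\<^sup>+\<omega>. (if u \<bullet> rvec (X m \<omega>) < L then 1 else 0) *
      ennreal (exp (\<theta> d * (u \<bullet> rvec (X (m + d) \<omega>) + K))) \<partial>N)
    \<le> ennreal (exp (2 * a * (L + K)))" for L m d
  proof (induction d)
    case 0
    show ?case
    proof (rule nn_integral_le_const)
      fix \<omega>
      have "\<theta> 0 = 2 * a" by (simp add: \<theta>_def)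
      then show "(if u \<bullet> rvec (X m \<omega>) < L then 1 else 0) *
          ennreal (exp (\<theta> 0 * (u \<bullet> rvec (X (m + 0) \<omega>) + K))) \<le> ennreal (exp (2 * a * (L + K)))"
        using a by (auto intro!: ennreal_leI)
    qed
  next
    case (Suc d)
    let ?\<theta> = "\<theta> (Suc d)"
    \<comment> \<open>The constant factor \<open>exp (?\<theta> * K)\<close> is moved into
      \<open>h\<close>, which leaves exactly an exponential of generation \<open>m + d + 1\<close>
      for \<open>drift\<close>.\<close>
    let ?h = "\<lambda>x. (if u \<bullet> rvec x < L then ennreal (exp (?\<theta> * K)) else 0)"
    have norm: "norm (?\<theta> *\<^sub>R u) \<le> ?\<theta>"
      using norm_u_le_1 \<theta>(1)[of "Suc d"] by (simp add: mult_left_le)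
    have "(\<integral>\<^sup>+\<omega>. (if u \<bullet> rvec (X m \<omega>) < L then 1 else 0) *
        ennreal (exp (?\<theta> * (u \<bullet> rvec (X (m + Suc d) \<omega>) + K))) \<partial>N)
      = (\<integral>\<^sup>+\<omega>. ?h (X m \<omega>) * ennreal (exp ((?\<theta> *\<^sub>R u) \<bullet> rvec (X (Suc (m + d)) \<omega>))) \<partial>N)"
      by (intro nn_integral_cong) (auto simp: exp_add algebra_simps simp flip: ennreal_mult)
    also have "\<dots> \<le> (\<integral>\<^sup>+\<omega>. ?h (X m \<omega>) *
        ennreal (exp ((M *v (?\<theta> *\<^sub>R u) + (C * (norm (?\<theta> *\<^sub>R u))\<^sup>2) *\<^sub>R u) \<bullet> rvec (X (m + d) \<omega>)
          + C * norm (?\<theta> *\<^sub>R u))) \<partial>N)"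
      using norm \<theta>_2a[of "Suc d"] a by (intro drift) auto
    also have "\<dots> \<le> (\<integral>\<^sup>+\<omega>. (if u \<bullet> rvec (X m \<omega>) < L then 1 else 0) *
        ennreal (exp (\<theta> d * (u \<bullet> rvec (X (m + d) \<omega>) + K))) \<partial>N)"
    proof (rule nn_integral_mono)
      fix \<omega>
      let ?x = "rvec (X (m + d) \<omega>)"
      have "(norm (?\<theta> *\<^sub>R u))\<^sup>2 \<le> ?\<theta>\<^sup>2" using norm by (intro power_mono) auto
      then have "C * (norm (?\<theta> *\<^sub>R u))\<^sup>2 \<le> C * ?\<theta>\<^sup>2"
        using C_nonneg by (rule mult_left_mono)
      then have "(\<rho> * ?\<theta> + C * (norm (?\<theta> *\<^sub>R u))\<^sup>2) * (u \<bullet> ?x) \<le> \<theta> d * (u \<bullet> ?x)"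
        using \<theta>_step[of d] u_rvec_nonneg by (intro mult_right_mono) auto
      moreover have "(M *v (?\<theta> *\<^sub>R u) + (C * (norm (?\<theta> *\<^sub>R u))\<^sup>2) *\<^sub>R u) \<bullet> ?x
          = (\<rho> * ?\<theta> + C * (norm (?\<theta> *\<^sub>R u))\<^sup>2) * (u \<bullet> ?x)"
        using right_eigenvector
        by (simp add: matrix_vector_mult_scaleR inner_add_left algebra_simps)
      moreover have "C * norm (?\<theta> *\<^sub>R u) + ?\<theta> * K \<le> \<theta> d * K"
      proof -
        have "C * norm (?\<theta> *\<^sub>R u) + ?\<theta> * K \<le> C * ?\<theta> + ?\<theta> * K"
          using mult_left_mono[OF norm C_nonneg] by simp
        also have "\<dots> = ?\<theta> * (\<rho> * K)" using K(2) by (simp add: algebra_simps)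
        also have "\<dots> = (\<rho> * ?\<theta>) * K" by simp
        also have "\<dots> \<le> \<theta> d * K"
        proof (rule mult_right_mono)
          have "0 \<le> C * ?\<theta>\<^sup>2" using C_nonneg by simp
          then show "\<rho> * ?\<theta> \<le> \<theta> d" using \<theta>_step[of d] by linarith
        qed (rule K(1))
        finally show ?thesis .
      qed
      ultimately have "?\<theta> * K + ((M *v (?\<theta> *\<^sub>R u) + (C * (norm (?\<theta> *\<^sub>R u))\<^sup>2) *\<^sub>R u) \<bullet> ?x
          + C * norm (?\<theta> *\<^sub>R u)) \<le> \<theta> d * (u \<bullet> ?x + K)"
        unfolding distrib_left by linarith
      then show "?h (X m \<omega>) *
        ennreal (exp ((M *v (?\<theta> *\<^sub>R u) + (C * (norm (?\<theta> *\<^sub>R u))\<^sup>2) *\<^sub>R u) \<bullet> ?x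
          + C * norm (?\<theta> *\<^sub>R u))) \<le> (if u \<bullet> rvec (X m \<omega>) < L then 1 else 0) *
        ennreal (exp (\<theta> d * (u \<bullet> ?x + K)))"
        by (auto intro!: ennreal_leI simp flip: ennreal_mult exp_add)
    qed
    also note Suc.IH
    finally show ?case .
  qed
  have "(\<integral>\<^sup>+\<omega>. (if u \<bullet> rvec (X m \<omega>) < L then 1 else 0) *
       ennreal (exp (a * (u \<bullet> rvec (X (m + d) \<omega>)) / \<rho> ^ d)) \<partial>N)
    \<le> ennreal (exp (2 * a * (L + K)))" for L m d
  proof (rule order_trans[OF nn_integral_mono main])
    fix \<omega>
    let ?x = "u \<bullet> rvec (X (m + d) \<omega>)"
    have "a * ?x / \<rho> ^ d = (a * \<tau> ^ d) * ?x"
      by (simp add: \<tau>_def power_divide)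
    also have "\<dots> \<le> \<theta> d * ?x"
      using \<theta>(3)[of d] u_rvec_nonneg by (rule mult_right_mono)
    also have "\<dots> \<le> \<theta> d * (?x + K)"
      using \<theta>(1)[of d] K(1) by (intro mult_left_mono) auto
    finally show "(if u \<bullet> rvec (X m \<omega>) < L then 1 else 0) * ennreal (exp (a * ?x / \<rho> ^ d))
        \<le> (if u \<bullet> rvec (X m \<omega>) < L then 1 else 0) * ennreal (exp (\<theta> d * (?x + K)))"
      by (intro mult_left_mono ennreal_leI) auto
  qed
  then show ?thesis using a(1) K(1) by blast
qed

text \<open>Fatou's lemma carries the supermartingale bound over to the limit, with
  \<open>s = a * \<rho> ^ m\<close> as the exponent of \<open>Y\<close>. Markov's inequality then
  gives the exponent \<open>- s * \<alpha> + 2 * a * (L + K)\<close>. The threshold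
  \<open>\<alpha> / 4\<close> is chosen so that \<open>2 * a * L\<close> is half of
  \<open>s * \<alpha>\<close>, and the other half is the decay.\<close>

lemma prob_small_population:
  fixes Y :: "'w \<Rightarrow> real"
  assumes Y: "Y \<in> borel_measurable N"
    and lim: "AE \<omega> in N. (\<lambda>n. (u \<bullet> rvec (X n \<omega>) - b n) / \<rho> ^ n) \<longlonglongrightarrow> Y \<omega>"
    and b: "\<And>n. 0 \<le> b n" and \<alpha>: "0 < \<alpha>"
  shows "\<exists>B c. 0 \<le> B \<and> 0 < c \<and> (\<forall>m. prob {\<omega> \<in> space N. \<alpha> \<le> Y \<omega> \<and> u \<bullet> rvec (X m \<omega>) < \<alpha> / 4 * \<rho> ^ m}
    \<le> B * exp (- c * \<rho> ^ m))"
proof -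
  obtain a K where a: "a > 0" "K \<ge> 0" and bound: "\<And>L m d.
    (\<integral>\<^sup>+\<omega>. (if u \<bullet> rvec (X m \<omega>) < L then 1 else 0) *
       ennreal (exp (a * (u \<bullet> rvec (X (m + d) \<omega>)) / \<rho> ^ d)) \<partial>N)
    \<le> ennreal (exp (2 * a * (L + K)))"
    using exponential_supermartingale by blast
  note [measurable] = Y
  have rho_pos: "0 < \<rho> ^ n" for n using rho_gt_1 by simp
  have "prob {\<omega> \<in> space N. \<alpha> \<le> Y \<omega> \<and> u \<bullet> rvec (X m \<omega>) < \<alpha> / 4 * \<rho> ^ m}
      \<le> exp (2 * a * K) * exp (- (a * \<alpha> / 2) * \<rho> ^ m)" for m
  proof -
    define L where "L = \<alpha> / 4 * \<rho> ^ m"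
    define s where "s = a * \<rho> ^ m"
    have s: "s > 0" using a rho_pos by (simp add: s_def)
    let ?G = "\<lambda>\<omega>. (if u \<bullet> rvec (X m \<omega>) < L then 1 else 0) :: ennreal"
    let ?Y = "\<lambda>n \<omega>. (u \<bullet> rvec (X n \<omega>) - b n) / \<rho> ^ n"
    define f where "f d \<omega> = ?G \<omega> * ennreal (exp (s * ?Y (m + d) \<omega>))" for d \<omega>
    have f_meas [measurable]: "f d \<in> borel_measurable N" for d
      unfolding f_def by measurable
    have f_bound: "(\<integral>\<^sup>+\<omega>. f d \<omega> \<partial>N) \<le> ennreal (exp (2 * a * (L + K)))" for d
    proof (rule order_trans[OF nn_integral_mono bound])
      fix \<omega>
      \<comment> \<open>The power \<open>\<rho> ^ m\<close> in \<open>s\<close> cancels, and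
        dropping the nonnegative centring \<open>b\<close> only raises the exponent.\<close>
      have "s * ?Y (m + d) \<omega> = a * (u \<bullet> rvec (X (m + d) \<omega>) - b (m + d)) / \<rho> ^ d"
        using rho_gt_1 by (simp add: s_def power_add)
      also have "\<dots> \<le> a * (u \<bullet> rvec (X (m + d) \<omega>)) / \<rho> ^ d"
        using b[of "m + d"] a rho_pos[of d] by (intro divide_right_mono mult_left_mono) auto
      finally show "f d \<omega> \<le> ?G \<omega> * ennreal (exp (a * (u \<bullet> rvec (X (m + d) \<omega>)) / \<rho> ^ d))"
        unfolding f_def by (intro mult_left_mono ennreal_leI) auto
    qed
    have "(\<integral>\<^sup>+\<omega>. ?G \<omega> * ennreal (exp (s * Y \<omega>)) \<partial>N) = (\<integral>\<^sup>+\<omega>. liminf (\<lambda>d. f d \<omega>) \<partial>N)"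
    proof (rule nn_integral_cong_AE, use lim in eventually_elim)
      fix \<omega> assume "(\<lambda>n. ?Y n \<omega>) \<longlonglongrightarrow> Y \<omega>"
      then have "(\<lambda>d. ?Y (m + d) \<omega>) \<longlonglongrightarrow> Y \<omega>"
        using LIMSEQ_ignore_initial_segment[of "\<lambda>n. ?Y n \<omega>" "Y \<omega>" m] by (simp add: add.commute)
      then have "(\<lambda>d. ennreal (exp (s * ?Y (m + d) \<omega>))) \<longlonglongrightarrow> ennreal (exp (s * Y \<omega>))"
        by (intro tendsto_intros)
      then have "(\<lambda>d. f d \<omega>) \<longlonglongrightarrow> ?G \<omega> * ennreal (exp (s * Y \<omega>))"
        unfolding f_def by (auto simp: if_split)
      then show "?G \<omega> * ennreal (exp (s * Y \<omega>)) = liminf (\<lambda>d. f d \<omega>)"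
        by (simp add: lim_imp_Liminf)
    qed
    also have "\<dots> \<le> liminf (\<lambda>d. \<integral>\<^sup>+\<omega>. f d \<omega> \<partial>N)"
      by (rule nn_integral_liminf) measurable
    also have "\<dots> \<le> ennreal (exp (2 * a * (L + K)))"
      using f_bound by (intro Liminf_le) auto
    finally have fatou: "(\<integral>\<^sup>+\<omega>. ?G \<omega> * ennreal (exp (s * Y \<omega>)) \<partial>N) \<le> ennreal (exp (2 * a * (L + K)))" .
    have "prob {\<omega> \<in> space N. \<alpha> \<le> Y \<omega> \<and> u \<bullet> rvec (X m \<omega>) < L}
        \<le> exp (- (s * \<alpha>)) * exp (2 * a * (L + K))"
    proof (rule prob_le_of_nn_integral[where f = "\<lambda>\<omega>. ennreal (exp (- (s * \<alpha>))) * (?G \<omega> * ennreal (exp (s * Y \<omega>)))"])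
      show "{\<omega> \<in> space N. \<alpha> \<le> Y \<omega> \<and> u \<bullet> rvec (X m \<omega>) < L} \<in> events" by measurable
      show "(\<integral>\<^sup>+\<omega>. ennreal (exp (- (s * \<alpha>))) * (?G \<omega> * ennreal (exp (s * Y \<omega>))) \<partial>N)
          \<le> ennreal (exp (- (s * \<alpha>)) * exp (2 * a * (L + K)))"
        using fatou by (subst nn_integral_cmult) (auto simp: ennreal_mult intro!: mult_left_mono)
      show "1 \<le> ennreal (exp (- (s * \<alpha>))) * (?G \<omega> * ennreal (exp (s * Y \<omega>)))"
        if "\<omega> \<in> {\<omega> \<in> space N. \<alpha> \<le> Y \<omega> \<and> u \<bullet> rvec (X m \<omega>) < L}" for \<omega>
        using that s by (auto simp flip: ennreal_mult exp_add)
    qed simp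
    also have "\<dots> = exp (2 * a * K) * exp (- (a * \<alpha> / 2) * \<rho> ^ m)"
      by (simp add: s_def L_def algebra_simps flip: exp_add)
    finally show ?thesis by (simp add: L_def)
  qed
  moreover have "0 < a * \<alpha> / 2" "0 \<le> exp (2 * a * K)" using a \<alpha> by simp_all
  ultimately show ?thesis by blast
qed

section \<open>Chernoff bounds over one and several generations\<close>

text \<open>At the exponent \<open>\<theta> *\<^sub>R w\<close> the offspring error is of order
  \<open>\<theta>\<^sup>2\<close> and the immigration error of order \<open>\<theta>\<close>. The
  three entries in \<open>\<theta>\<^sub>1\<close> ensure, in this order, that \<open>drift\<close>
  applies, that the offspring error is at most \<open>\<theta> * \<delta>\<close> along
  \<open>u\<close>, and that the immigration error is at most 1.\<close>

lemma drift_linear: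
  assumes "\<delta> > 0"
  shows "\<exists>\<theta>\<^sub>1>0. \<forall>\<theta> h m n. 0 < \<theta> \<longrightarrow> \<theta> \<le> \<theta>\<^sub>1 \<longrightarrow> m \<le> n \<longrightarrow>
    (\<integral>\<^sup>+\<omega>. h (X m \<omega>) * ennreal (exp (\<theta> * (w \<bullet> rvec (X (Suc n) \<omega>)))) \<partial>N)
    \<le> (\<integral>\<^sup>+\<omega>. h (X m \<omega>) * ennreal (exp (\<theta> * ((M *v w + \<delta> *\<^sub>R u) \<bullet> rvec (X n \<omega>)) + 1)) \<partial>N)"
proof -
  define \<theta>\<^sub>1 where
    "\<theta>\<^sub>1 = min (r / (norm w + 1)) (min (\<delta> / (C * (norm w)\<^sup>2 + 1)) (1 / (C * norm w + 1)))"
  have pos: "norm w + 1 > 0" "C * (norm w)\<^sup>2 + 1 > 0" "C * norm w + 1 > 0"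
    using C_nonneg by (auto intro!: add_nonneg_pos)
  have "\<theta>\<^sub>1 > 0" using pos r_pos assms by (simp add: \<theta>\<^sub>1_def)
  moreover have "(\<integral>\<^sup>+\<omega>. h (X m \<omega>) * ennreal (exp (\<theta> * (w \<bullet> rvec (X (Suc n) \<omega>)))) \<partial>N)
    \<le> (\<integral>\<^sup>+\<omega>. h (X m \<omega>) * ennreal (exp (\<theta> * ((M *v w + \<delta> *\<^sub>R u) \<bullet> rvec (X n \<omega>)) + 1)) \<partial>N)"
    if \<theta>: "0 < \<theta>" "\<theta> \<le> \<theta>\<^sub>1" and mn: "m \<le> n" for \<theta> h m n
  proof -
    have "\<theta> \<le> r / (norm w + 1)" "\<theta> \<le> \<delta> / (C * (norm w)\<^sup>2 + 1)" "\<theta> \<le> 1 / (C * norm w + 1)"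
      using \<theta>(2) by (auto simp: \<theta>\<^sub>1_def)
    then have b: "\<theta> * norm w \<le> r" "C * (norm w)\<^sup>2 * \<theta> \<le> \<delta>" "C * norm w * \<theta> \<le> 1"
      using pos \<theta>(1) by (auto simp: field_simps)
    have nw: "norm (\<theta> *\<^sub>R w) = \<theta> * norm w" using \<theta>(1) by simp
    have "(\<integral>\<^sup>+\<omega>. h (X m \<omega>) * ennreal (exp ((\<theta> *\<^sub>R w) \<bullet> rvec (X (Suc n) \<omega>))) \<partial>N)
      \<le> (\<integral>\<^sup>+\<omega>. h (X m \<omega>) * ennreal (exp ((M *v (\<theta> *\<^sub>R w) + (C * (norm (\<theta> *\<^sub>R w))\<^sup>2) *\<^sub>R u)
          \<bullet> rvec (X n \<omega>) + C * norm (\<theta> *\<^sub>R w))) \<partial>N)"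
      by (rule drift[OF _ mn]) (use b(1) in \<open>simp only: nw\<close>)
    also have "\<dots> \<le> (\<integral>\<^sup>+\<omega>. h (X m \<omega>) *
        ennreal (exp (\<theta> * ((M *v w + \<delta> *\<^sub>R u) \<bullet> rvec (X n \<omega>)) + 1)) \<partial>N)"
    proof (intro nn_integral_mono mult_left_mono ennreal_leI exp_le_cancel_iff[THEN iffD2])
      fix \<omega>
      let ?x = "rvec (X n \<omega>)"
      have "\<theta> * (C * (norm w)\<^sup>2 * \<theta>) * (u \<bullet> ?x) \<le> \<theta> * \<delta> * (u \<bullet> ?x)"
        using b(2) \<theta>(1) u_rvec_nonneg by (intro mult_right_mono mult_left_mono) auto
      then have "C * (norm (\<theta> *\<^sub>R w))\<^sup>2 * (u \<bullet> ?x) \<le> \<theta> * \<delta> * (u \<bullet> ?x)"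
        by (simp only: nw) (simp add: power2_eq_square mult_ac)
      moreover have "C * norm (\<theta> *\<^sub>R w) \<le> 1"
        using b(3) by (simp only: nw) (simp add: mult_ac)
      ultimately show "(M *v (\<theta> *\<^sub>R w) + (C * (norm (\<theta> *\<^sub>R w))\<^sup>2) *\<^sub>R u) \<bullet> ?x + C * norm (\<theta> *\<^sub>R w)
          \<le> \<theta> * ((M *v w + \<delta> *\<^sub>R u) \<bullet> ?x) + 1"
        by (simp add: matrix_vector_mult_scaleR inner_add_left distrib_left mult.assoc)
    qed auto
    finally show ?thesis by simp
  qed
  ultimately show ?thesis by blast
qed

text \<open>Chernoff's bound with the compensator \<open>exp (- \<theta> * ((M *v w + \<epsilon>
  *\<^sub>R u) \<bullet> rvec x))\<close> put into \<open>h\<close>. The drift with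
  \<open>\<delta> = \<epsilon> / 2\<close> uses half of the margin; the other half leaves
  \<open>- \<theta> * \<epsilon> / 2 * (u \<bullet> rvec x)\<close>, which is at most
  \<open>- \<theta> * \<epsilon> / 2 * L\<close> on the event.\<close>

lemma prob_one_step_deviation:
  assumes "\<epsilon> > 0"
  shows "\<exists>c>0. \<forall>n L. prob {\<omega> \<in> space N. L \<le> u \<bullet> rvec (X n \<omega>) \<and>
      \<epsilon> * (u \<bullet> rvec (X n \<omega>)) < w \<bullet> rvec (X (Suc n) \<omega>) - (M *v w) \<bullet> rvec (X n \<omega>)}
    \<le> exp (1 - c * L)"
proof -
  obtain \<theta> where \<theta>: "\<theta> > 0" and le: "\<And>h n.
    (\<integral>\<^sup>+\<omega>. h (X n \<omega>) * ennreal (exp (\<theta> * (w \<bullet> rvec (X (Suc n) \<omega>)))) \<partial>N)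
    \<le> (\<integral>\<^sup>+\<omega>. h (X n \<omega>) * ennreal (exp (\<theta> * ((M *v w + (\<epsilon> / 2) *\<^sub>R u) \<bullet> rvec (X n \<omega>)) + 1)) \<partial>N)"
    using drift_linear[of "\<epsilon> / 2" w] assms by auto
  have "prob {\<omega> \<in> space N. L \<le> u \<bullet> rvec (X n \<omega>) \<and>
      \<epsilon> * (u \<bullet> rvec (X n \<omega>)) < w \<bullet> rvec (X (Suc n) \<omega>) - (M *v w) \<bullet> rvec (X n \<omega>)}
    \<le> exp (1 - \<theta> * \<epsilon> / 2 * L)" (is "prob ?E \<le> _") for n L
  proof -
    define h where "h x = (if L \<le> u \<bullet> rvec x
      then ennreal (exp (- \<theta> * ((M *v w + \<epsilon> *\<^sub>R u) \<bullet> rvec x))) else 0)" for x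
    show ?thesis
    proof (rule prob_le_of_nn_integral[where
          f = "\<lambda>\<omega>. h (X n \<omega>) * ennreal (exp (\<theta> * (w \<bullet> rvec (X (Suc n) \<omega>))))"])
      show "?E \<in> events" by measurable
      show "1 \<le> h (X n \<omega>) * ennreal (exp (\<theta> * (w \<bullet> rvec (X (Suc n) \<omega>))))" if "\<omega> \<in> ?E" for \<omega>
      proof -
        have "0 \<le> \<theta> * (w \<bullet> rvec (X (Suc n) \<omega>) - (M *v w) \<bullet> rvec (X n \<omega>) - \<epsilon> * (u \<bullet> rvec (X n \<omega>)))"
          using that \<theta> by auto
        then show ?thesis
          using that by (auto simp: h_def inner_add_left algebra_simps simp flip: ennreal_mult exp_add)
      qed
      have "(\<integral>\<^sup>+\<omega>. h (X n \<omega>) *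
          ennreal (exp (\<theta> * ((M *v w + (\<epsilon> / 2) *\<^sub>R u) \<bullet> rvec (X n \<omega>)) + 1)) \<partial>N)
        \<le> ennreal (exp (1 - \<theta> * \<epsilon> / 2 * L))"
      proof (rule nn_integral_le_const)
        fix \<omega>
        have "\<theta> * \<epsilon> / 2 * L \<le> \<theta> * \<epsilon> / 2 * (u \<bullet> rvec (X n \<omega>))" if "L \<le> u \<bullet> rvec (X n \<omega>)"
          using that \<theta> assms by (intro mult_left_mono) auto
        then show "h (X n \<omega>) *
          ennreal (exp (\<theta> * ((M *v w + (\<epsilon> / 2) *\<^sub>R u) \<bullet> rvec (X n \<omega>)) + 1))
          \<le> ennreal (exp (1 - \<theta> * \<epsilon> / 2 * L))"
          by (auto simp: h_def inner_add_left algebra_simps intro!: ennreal_leI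
              simp flip: ennreal_mult exp_add)
      qed
      then show "(\<integral>\<^sup>+\<omega>. h (X n \<omega>) * ennreal (exp (\<theta> * (w \<bullet> rvec (X (Suc n) \<omega>)))) \<partial>N)
          \<le> ennreal (exp (1 - \<theta> * \<epsilon> / 2 * L))"
        by (rule order_trans[OF le])
    qed simp
  qed
  moreover have "\<theta> * \<epsilon> / 2 > 0" using \<theta> assms by simp
  ultimately show ?thesis by blast
qed

text \<open>One generation turns the coefficient \<open>a\<close> of \<open>z\<close> into
  \<open>a * \<mu>\<close> exactly. On \<open>u\<close> it would turn \<open>- b\<close> into
  \<open>- b * \<rho>\<close>; the error \<open>\<delta> = b * (\<rho> - \<rho>')\<close> is spent
  there and leaves \<open>- b * \<rho>'\<close>. Each generation adds 1 to the exponent. The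
  induction changes \<open>a\<close> and \<open>b\<close>, since the latest generation is integrated
  first and the hypothesis is used at \<open>a * \<mu>\<close> and
  \<open>b * \<rho>'\<close>.\<close>

lemma drift_eigenvector:
  assumes z: "M *v z = \<mu> *\<^sub>R z" and \<rho>': "0 < \<rho>'" "\<rho>' < \<rho>" and b: "b > 0"
  shows "\<exists>\<theta>\<^sub>1>0. \<forall>\<theta> h m. 0 < \<theta> \<longrightarrow> \<theta> \<le> \<theta>\<^sub>1 \<longrightarrow>
    (\<integral>\<^sup>+\<omega>. h (X m \<omega>) * ennreal (exp (\<theta> * ((a *\<^sub>R z - b *\<^sub>R u) \<bullet> rvec (X (m + k) \<omega>)))) \<partial>N)
    \<le> (\<integral>\<^sup>+\<omega>. h (X m \<omega>) * ennreal (exp (\<theta> *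
        (((a * \<mu> ^ k) *\<^sub>R z - (b * \<rho>' ^ k) *\<^sub>R u) \<bullet> rvec (X m \<omega>)) + real k)) \<partial>N)"
  using b
proof (induction k arbitrary: a b)
  case 0
  show ?case by (intro exI[of _ 1]) auto
next
  case (Suc k)
  have "b * \<rho>' > 0" "b * (\<rho> - \<rho>') > 0" using Suc.prems \<rho>' by auto
  from Suc.IH[OF this(1), of "a * \<mu>"] drift_linear[OF this(2), of "a *\<^sub>R z - b *\<^sub>R u"]
  obtain \<theta>\<^sub>1 \<theta>\<^sub>2 where \<theta>\<^sub>1: "\<theta>\<^sub>1 > 0" "\<theta>\<^sub>2 > 0" and IH: "\<And>\<theta> h m. 0 < \<theta> \<Longrightarrow> \<theta> \<le> \<theta>\<^sub>1 \<Longrightarrow>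
      (\<integral>\<^sup>+\<omega>. h (X m \<omega>) * ennreal (exp (\<theta> *
        (((a * \<mu>) *\<^sub>R z - (b * \<rho>') *\<^sub>R u) \<bullet> rvec (X (m + k) \<omega>)))) \<partial>N)
      \<le> (\<integral>\<^sup>+\<omega>. h (X m \<omega>) * ennreal (exp (\<theta> *
        (((a * \<mu> * \<mu> ^ k) *\<^sub>R z - (b * \<rho>' * \<rho>' ^ k) *\<^sub>R u) \<bullet> rvec (X m \<omega>)) + real k)) \<partial>N)"
    and step: "\<And>\<theta> h m n. 0 < \<theta> \<Longrightarrow> \<theta> \<le> \<theta>\<^sub>2 \<Longrightarrow> m \<le> n \<Longrightarrow>
      (\<integral>\<^sup>+\<omega>. h (X m \<omega>) * ennreal (exp (\<theta> * ((a *\<^sub>R z - b *\<^sub>R u) \<bullet> rvec (X (Suc n) \<omega>)))) \<partial>N)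
      \<le> (\<integral>\<^sup>+\<omega>. h (X m \<omega>) * ennreal (exp (\<theta> * ((M *v (a *\<^sub>R z - b *\<^sub>R u) +
          (b * (\<rho> - \<rho>')) *\<^sub>R u) \<bullet> rvec (X n \<omega>)) + 1)) \<partial>N)"
    by blast
  have vec: "M *v (a *\<^sub>R z - b *\<^sub>R u) + (b * (\<rho> - \<rho>')) *\<^sub>R u = (a * \<mu>) *\<^sub>R z - (b * \<rho>') *\<^sub>R u"
    using z right_eigenvector
    by (simp add: matrix_vector_mult_diff_distrib matrix_vector_mult_scaleR algebra_simps)
  show ?case
  proof (intro exI[of _ "min \<theta>\<^sub>1 \<theta>\<^sub>2"] conjI allI impI)
    fix \<theta> :: real and h :: "nat ^ 2 \<Rightarrow> ennreal" and m
    assume \<theta>: "0 < \<theta>" "\<theta> \<le> min \<theta>\<^sub>1 \<theta>\<^sub>2"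
    have "(\<integral>\<^sup>+\<omega>. h (X m \<omega>) * ennreal (exp (\<theta> * ((a *\<^sub>R z - b *\<^sub>R u) \<bullet> rvec (X (m + Suc k) \<omega>)))) \<partial>N)
      \<le> (\<integral>\<^sup>+\<omega>. h (X m \<omega>) * ennreal (exp (\<theta> *
        (((a * \<mu>) *\<^sub>R z - (b * \<rho>') *\<^sub>R u) \<bullet> rvec (X (m + k) \<omega>)) + 1)) \<partial>N)"
      using step[of \<theta> m "m + k" h] \<theta> unfolding vec by simp
    also have "\<dots> = (\<integral>\<^sup>+\<omega>. h (X m \<omega>) * ennreal (exp 1) * ennreal (exp (\<theta> *
        (((a * \<mu>) *\<^sub>R z - (b * \<rho>') *\<^sub>R u) \<bullet> rvec (X (m + k) \<omega>)))) \<partial>N)"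
      by (simp add: exp_add ennreal_mult mult_ac)
    also have "\<dots> \<le> (\<integral>\<^sup>+\<omega>. h (X m \<omega>) * ennreal (exp 1) * ennreal (exp (\<theta> *
        (((a * \<mu> * \<mu> ^ k) *\<^sub>R z - (b * \<rho>' * \<rho>' ^ k) *\<^sub>R u) \<bullet> rvec (X m \<omega>)) + real k)) \<partial>N)"
      using IH[of \<theta> "\<lambda>x. h x * ennreal (exp 1)" m] \<theta> by simp
    also have "\<dots> = (\<integral>\<^sup>+\<omega>. h (X m \<omega>) * ennreal (exp (\<theta> *
        (((a * \<mu> ^ Suc k) *\<^sub>R z - (b * \<rho>' ^ Suc k) *\<^sub>R u) \<bullet> rvec (X m \<omega>)) + real (Suc k))) \<partial>N)"
      by (simp add: exp_add ennreal_mult mult_ac)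
    finally show "(\<integral>\<^sup>+\<omega>. h (X m \<omega>) *
        ennreal (exp (\<theta> * ((a *\<^sub>R z - b *\<^sub>R u) \<bullet> rvec (X (m + Suc k) \<omega>)))) \<partial>N)
      \<le> (\<integral>\<^sup>+\<omega>. h (X m \<omega>) * ennreal (exp (\<theta> *
        (((a * \<mu> ^ Suc k) *\<^sub>R z - (b * \<rho>' ^ Suc k) *\<^sub>R u) \<bullet> rvec (X m \<omega>)) + real (Suc k))) \<partial>N)" .
  qed (use \<theta>\<^sub>1 in simp)
qed

text \<open>With \<open>\<rho>'\<close> strictly between \<open>\<bar>\<mu>\<bar>\<close> and
  \<open>\<rho>\<close>, some fixed \<open>k\<close> makes \<open>\<mu> ^ k\<close> times
  \<open>z\<close> componentwise at most \<open>\<epsilon> / 2 * \<rho>' ^ k\<close> times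
  \<open>u\<close> in modulus. Traced back over \<open>k\<close> generations, the exponent for
  \<open>z - \<epsilon> *\<^sub>R u\<close> thus becomes a negative multiple of
  \<open>u \<bullet> rvec (X m \<omega>)\<close>, up to \<open>real k\<close>. The factor 2 accounts
  for the two signs of \<open>z\<close>.\<close>

lemma prob_eigenvector_deviation:
  assumes z: "M *v z = \<mu> *\<^sub>R z" and \<mu>: "\<bar>\<mu>\<bar> < \<rho>" and \<epsilon>: "\<epsilon> > 0"
  shows "\<exists>c>0. \<exists>k. \<forall>m. \<forall>L\<ge>0. prob {\<omega> \<in> space N. L \<le> u \<bullet> rvec (X m \<omega>) \<and>
      \<epsilon> * (u \<bullet> rvec (X (m + k) \<omega>)) < \<bar>z \<bullet> rvec (X (m + k) \<omega>)\<bar>}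
    \<le> 2 * exp (real k - c * L)"
proof -
  obtain \<rho>' where \<rho>': "\<bar>\<mu>\<bar> < \<rho>'" "\<rho>' < \<rho>" using \<mu> dense by blast
  then have \<rho>'_pos: "0 < \<rho>'" by linarith
  have "(\<lambda>k. (\<bar>\<mu>\<bar> / \<rho>') ^ k * \<bar>z $ t\<bar>) \<longlonglongrightarrow> 0 * \<bar>z $ t\<bar>" for t
    using \<rho>' \<rho>'_pos by (intro tendsto_mult LIMSEQ_realpow_zero tendsto_const) auto
  then have "\<forall>\<^sub>F k in sequentially. (\<bar>\<mu>\<bar> / \<rho>') ^ k * \<bar>z $ t\<bar> < \<epsilon> / 2 * u $ t" for t
    by (rule order_tendstoD(2)) (use u_pos \<epsilon> in simp)
  then have "\<forall>\<^sub>F k in sequentially. \<forall>t. (\<bar>\<mu>\<bar> / \<rho>') ^ k * \<bar>z $ t\<bar> < \<epsilon> / 2 * u $ t"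
    by (simp add: eventually_all_finite)
  then obtain k where k: "\<And>t. (\<bar>\<mu>\<bar> / \<rho>') ^ k * \<bar>z $ t\<bar> < \<epsilon> / 2 * u $ t"
    by (auto simp: eventually_sequentially)
  have small: "\<bar>\<mu> ^ k * z $ t\<bar> \<le> \<epsilon> / 2 * \<rho>' ^ k * u $ t" for t
  proof -
    have "\<bar>\<mu>\<bar> ^ k / \<rho>' ^ k * \<bar>z $ t\<bar> \<le> \<epsilon> / 2 * u $ t"
      using k[of t] by (simp add: power_divide)
    then show ?thesis using \<rho>'_pos by (simp add: abs_mult power_abs field_simps)
  qed
  have one_sided: "\<exists>c>0. \<forall>m L. prob {\<omega> \<in> space N. L \<le> u \<bullet> rvec (X m \<omega>) \<and>
      \<epsilon> * (u \<bullet> rvec (X (m + k) \<omega>)) < a * (z \<bullet> rvec (X (m + k) \<omega>))}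
    \<le> exp (real k - c * L)" if a: "\<bar>a\<bar> = 1" for a
  proof -
    obtain \<theta> where \<theta>: "\<theta> > 0" and le: "\<And>h m.
      (\<integral>\<^sup>+\<omega>. h (X m \<omega>) * ennreal (exp (\<theta> * ((a *\<^sub>R z - \<epsilon> *\<^sub>R u) \<bullet> rvec (X (m + k) \<omega>)))) \<partial>N)
      \<le> (\<integral>\<^sup>+\<omega>. h (X m \<omega>) * ennreal (exp (\<theta> *
        (((a * \<mu> ^ k) *\<^sub>R z - (\<epsilon> * \<rho>' ^ k) *\<^sub>R u) \<bullet> rvec (X m \<omega>)) + real k)) \<partial>N)"
      using drift_eigenvector[OF z \<rho>'_pos \<rho>'(2) \<epsilon>, of a k] by blast
    define c where "c = \<theta> * (\<epsilon> / 2 * \<rho>' ^ k)"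
    have c: "c > 0" using \<theta> \<epsilon> \<rho>'_pos by (simp add: c_def)
    have "prob {\<omega> \<in> space N. L \<le> u \<bullet> rvec (X m \<omega>) \<and>
      \<epsilon> * (u \<bullet> rvec (X (m + k) \<omega>)) < a * (z \<bullet> rvec (X (m + k) \<omega>))}
    \<le> exp (real k - c * L)" (is "prob ?E \<le> _") for m L
    proof -
      let ?h = "\<lambda>x. (if L \<le> u \<bullet> rvec x then 1 else 0) :: ennreal"
      show ?thesis
      proof (rule prob_le_of_nn_integral[where f = "\<lambda>\<omega>. ?h (X m \<omega>) *
            ennreal (exp (\<theta> * ((a *\<^sub>R z - \<epsilon> *\<^sub>R u) \<bullet> rvec (X (m + k) \<omega>))))"])
        show "?E \<in> events" by measurable
        show "1 \<le> ?h (X m \<omega>) * ennreal (exp (\<theta> * ((a *\<^sub>R z - \<epsilon> *\<^sub>R u) \<bullet> rvec (X (m + k) \<omega>))))"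
          if "\<omega> \<in> ?E" for \<omega>
          using that \<theta> by (auto simp: inner_diff_left)
        have "(\<integral>\<^sup>+\<omega>. ?h (X m \<omega>) * ennreal (exp (\<theta> *
          (((a * \<mu> ^ k) *\<^sub>R z - (\<epsilon> * \<rho>' ^ k) *\<^sub>R u) \<bullet> rvec (X m \<omega>)) + real k)) \<partial>N)
          \<le> ennreal (exp (real k - c * L))"
        proof (rule nn_integral_le_const)
          fix \<omega>
          let ?x = "rvec (X m \<omega>)"
          have "((a * \<mu> ^ k) *\<^sub>R z) \<bullet> ?x \<le> ((\<epsilon> / 2 * \<rho>' ^ k) *\<^sub>R u) \<bullet> ?x"
          proof (rule inner_rvec_mono)
            fix t
            have "a * \<mu> ^ k * z $ t \<le> \<bar>\<mu> ^ k * z $ t\<bar>"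
              using a abs_ge_self[of "a * (\<mu> ^ k * z $ t)"] by (simp add: abs_mult mult.assoc)
            with small[of t] show "((a * \<mu> ^ k) *\<^sub>R z) $ t \<le> ((\<epsilon> / 2 * \<rho>' ^ k) *\<^sub>R u) $ t" by simp
          qed
          then have "((a * \<mu> ^ k) *\<^sub>R z - (\<epsilon> * \<rho>' ^ k) *\<^sub>R u) \<bullet> ?x \<le> - (\<epsilon> / 2 * \<rho>' ^ k) * (u \<bullet> ?x)"
            by (simp add: inner_diff_left algebra_simps)
          then have "\<theta> * (((a * \<mu> ^ k) *\<^sub>R z - (\<epsilon> * \<rho>' ^ k) *\<^sub>R u) \<bullet> ?x)
              \<le> \<theta> * (- (\<epsilon> / 2 * \<rho>' ^ k) * (u \<bullet> ?x))"
            using \<theta> by (intro mult_left_mono) auto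
          also have "\<dots> = - (c * (u \<bullet> ?x))" by (simp add: c_def)
          finally have "\<theta> * (((a * \<mu> ^ k) *\<^sub>R z - (\<epsilon> * \<rho>' ^ k) *\<^sub>R u) \<bullet> ?x) \<le> - (c * (u \<bullet> ?x))" .
          moreover have "c * L \<le> c * (u \<bullet> ?x)" if "L \<le> u \<bullet> ?x"
            using that c by (intro mult_left_mono) auto
          ultimately show "?h (X m \<omega>) * ennreal (exp (\<theta> *
              (((a * \<mu> ^ k) *\<^sub>R z - (\<epsilon> * \<rho>' ^ k) *\<^sub>R u) \<bullet> ?x) + real k))
              \<le> ennreal (exp (real k - c * L))"
            by (auto intro!: ennreal_leI)
        qed
        then show "(\<integral>\<^sup>+\<omega>. ?h (X m \<omega>) *
            ennreal (exp (\<theta> * ((a *\<^sub>R z - \<epsilon> *\<^sub>R u) \<bullet> rvec (X (m + k) \<omega>)))) \<partial>N)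
            \<le> ennreal (exp (real k - c * L))"
          by (rule order_trans[OF le])
      qed simp
    qed
    with c show ?thesis by blast
  qed
  obtain c\<^sub>1 c\<^sub>2 where c: "c\<^sub>1 > 0" "c\<^sub>2 > 0"
    and b1: "\<And>m L. prob {\<omega> \<in> space N. L \<le> u \<bullet> rvec (X m \<omega>) \<and>
      \<epsilon> * (u \<bullet> rvec (X (m + k) \<omega>)) < 1 * (z \<bullet> rvec (X (m + k) \<omega>))} \<le> exp (real k - c\<^sub>1 * L)"
    and b2: "\<And>m L. prob {\<omega> \<in> space N. L \<le> u \<bullet> rvec (X m \<omega>) \<and>
      \<epsilon> * (u \<bullet> rvec (X (m + k) \<omega>)) < (-1) * (z \<bullet> rvec (X (m + k) \<omega>))} \<le> exp (real k - c\<^sub>2 * L)"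
    using one_sided[of 1] one_sided[of "-1"] by auto
  have "prob {\<omega> \<in> space N. L \<le> u \<bullet> rvec (X m \<omega>) \<and>
      \<epsilon> * (u \<bullet> rvec (X (m + k) \<omega>)) < \<bar>z \<bullet> rvec (X (m + k) \<omega>)\<bar>}
    \<le> 2 * exp (real k - min c\<^sub>1 c\<^sub>2 * L)" if "L \<ge> 0" for m L
  proof -
    have "prob {\<omega> \<in> space N. L \<le> u \<bullet> rvec (X m \<omega>) \<and>
        \<epsilon> * (u \<bullet> rvec (X (m + k) \<omega>)) < \<bar>z \<bullet> rvec (X (m + k) \<omega>)\<bar>}
      \<le> prob ({\<omega> \<in> space N. L \<le> u \<bullet> rvec (X m \<omega>) \<and>
          \<epsilon> * (u \<bullet> rvec (X (m + k) \<omega>)) < 1 * (z \<bullet> rvec (X (m + k) \<omega>))} \<union>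
        {\<omega> \<in> space N. L \<le> u \<bullet> rvec (X m \<omega>) \<and>
          \<epsilon> * (u \<bullet> rvec (X (m + k) \<omega>)) < (-1) * (z \<bullet> rvec (X (m + k) \<omega>))})"
      by (intro finite_measure_mono) auto
    also have "\<dots> \<le> exp (real k - c\<^sub>1 * L) + exp (real k - c\<^sub>2 * L)"
      by (intro order_trans[OF measure_Un_le] add_mono b1 b2) measurable
    \<comment> \<open>Since \<open>L \<ge> 0\<close>, the smaller rate may replace both.\<close>
    also have "\<dots> \<le> exp (real k - min c\<^sub>1 c\<^sub>2 * L) + exp (real k - min c\<^sub>1 c\<^sub>2 * L)"
      using that by (intro add_mono) (auto intro!: mult_right_mono)
    finally show ?thesis by simp
  qed
  moreover have "min c\<^sub>1 c\<^sub>2 > 0" using c by simp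
  ultimately show ?thesis by blast
qed

end

section \<open>Deviations on the event that the limit is large\<close>

context exponential_drift
begin

context
  fixes Y :: "'w \<Rightarrow> real" and b :: "nat \<Rightarrow> real" and \<alpha> \<epsilon> :: real
  assumes Y: "Y \<in> borel_measurable N"
    and lim: "AE \<omega> in N. (\<lambda>n. (u \<bullet> rvec (X n \<omega>) - b n) / \<rho> ^ n) \<longlonglongrightarrow> Y \<omega>"
    and b_nonneg: "\<And>n. 0 \<le> b n" and \<alpha>: "0 < \<alpha>" and \<epsilon>: "0 < \<epsilon>"
begin

text \<open>Either \<open>u \<bullet> rvec (X n \<omega>)\<close> is below
  \<open>\<alpha> / 4 * \<rho> ^ n\<close>, which is unlikely on
  \<open>\<alpha> \<le> Y \<omega>\<close>, or the one-step bound applies with this value as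
  \<open>L\<close>, once to \<open>l\<close> and once to \<open>- l\<close>. Passing from the
  weights 1 to the smaller weights \<open>u\<close> only enlarges the event.\<close>

lemma prob_offspring_deviation:
  "\<exists>B c. 0 < c \<and> (\<forall>n. prob {\<omega> \<in> space N. \<alpha> \<le> Y \<omega> \<and>
      \<epsilon> * (1 \<bullet> rvec (X n \<omega>)) < \<bar>l \<bullet> rvec (X (Suc n) \<omega>) - (M *v l) \<bullet> rvec (X n \<omega>)\<bar>}
    \<le> B * exp (- c * \<rho> ^ n))"
proof -
  note [measurable] = Y
  obtain B c\<^sub>0 where B: "B \<ge> 0" "c\<^sub>0 > 0" and small: "\<And>m.
      prob {\<omega> \<in> space N. \<alpha> \<le> Y \<omega> \<and> u \<bullet> rvec (X m \<omega>) < \<alpha> / 4 * \<rho> ^ m} \<le> B * exp (- c\<^sub>0 * \<rho> ^ m)"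
    using prob_small_population[OF Y lim b_nonneg \<alpha>] by blast
  let ?A = "\<lambda>w n. {\<omega> \<in> space N. \<alpha> / 4 * \<rho> ^ n \<le> u \<bullet> rvec (X n \<omega>) \<and>
      \<epsilon> * (u \<bullet> rvec (X n \<omega>)) < w \<bullet> rvec (X (Suc n) \<omega>) - (M *v w) \<bullet> rvec (X n \<omega>)}"
  obtain c\<^sub>1 c\<^sub>2 where c: "c\<^sub>1 > 0" "c\<^sub>2 > 0"
    and dev: "\<And>n. prob (?A l n) \<le> exp (1 - c\<^sub>1 * (\<alpha> / 4 * \<rho> ^ n))"
      "\<And>n. prob (?A (- l) n) \<le> exp (1 - c\<^sub>2 * (\<alpha> / 4 * \<rho> ^ n))"
    using prob_one_step_deviation[OF \<epsilon>, of l] prob_one_step_deviation[OF \<epsilon>, of "- l"] by blast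
  define c where "c = min c\<^sub>0 (min (c\<^sub>1 * \<alpha> / 4) (c\<^sub>2 * \<alpha> / 4))"
  have c_le: "c \<le> c\<^sub>0" "c \<le> c\<^sub>1 * \<alpha> / 4" "c \<le> c\<^sub>2 * \<alpha> / 4" by (auto simp: c_def)
  have "prob {\<omega> \<in> space N. \<alpha> \<le> Y \<omega> \<and>
      \<epsilon> * (1 \<bullet> rvec (X n \<omega>)) < \<bar>l \<bullet> rvec (X (Suc n) \<omega>) - (M *v l) \<bullet> rvec (X n \<omega>)\<bar>}
    \<le> (B + 2 * exp 1) * exp (- c * \<rho> ^ n)" for n
  proof -
    have rho_n: "\<rho> ^ n \<ge> 0" using rho_gt_1 by simp
    let ?S = "{\<omega> \<in> space N. \<alpha> \<le> Y \<omega> \<and> u \<bullet> rvec (X n \<omega>) < \<alpha> / 4 * \<rho> ^ n}"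
    have "prob {\<omega> \<in> space N. \<alpha> \<le> Y \<omega> \<and>
        \<epsilon> * (1 \<bullet> rvec (X n \<omega>)) < \<bar>l \<bullet> rvec (X (Suc n) \<omega>) - (M *v l) \<bullet> rvec (X n \<omega>)\<bar>}
      \<le> prob (?S \<union> (?A l n \<union> ?A (- l) n))"
    proof (rule finite_measure_mono)
      have "\<epsilon> * (u \<bullet> rvec (X n \<omega>)) \<le> \<epsilon> * (1 \<bullet> rvec (X n \<omega>))" for \<omega>
        using \<epsilon> u_rvec_le by (intro mult_left_mono) auto
      note le = order.strict_trans1[OF this]
      have neg: "M *v (- l) = - (M *v l)"
        by (simp add: vec_eq_iff matrix_vector_mult_def sum_negf)
      show "{\<omega> \<in> space N. \<alpha> \<le> Y \<omega> \<and>
        \<epsilon> * (1 \<bullet> rvec (X n \<omega>)) < \<bar>l \<bullet> rvec (X (Suc n) \<omega>) - (M *v l) \<bullet> rvec (X n \<omega>)\<bar>}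
        \<subseteq> ?S \<union> (?A l n \<union> ?A (- l) n)"
        by (auto dest!: le simp: abs_if neg split: if_splits)
    qed measurable
    also have "\<dots> \<le> prob ?S + (prob (?A l n) + prob (?A (- l) n))"
      by (intro order_trans[OF measure_Un_le] add_mono order_refl measure_Un_le) measurable
    also have "\<dots> \<le> B * exp (- c * \<rho> ^ n) + (exp 1 * exp (- c * \<rho> ^ n) + exp 1 * exp (- c * \<rho> ^ n))"
    proof (intro add_mono)
      show "prob ?S \<le> B * exp (- c * \<rho> ^ n)"
        using c_le rho_n B by (intro order_trans[OF small] mult_left_mono) (auto intro: mult_right_mono)
      show "prob (?A l n) \<le> exp 1 * exp (- c * \<rho> ^ n)"
        using mult_right_mono[OF c_le(2) rho_n]
        by (intro order_trans[OF dev(1)]) (simp flip: exp_add)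
      show "prob (?A (- l) n) \<le> exp 1 * exp (- c * \<rho> ^ n)"
        using mult_right_mono[OF c_le(3) rho_n]
        by (intro order_trans[OF dev(2)]) (simp flip: exp_add)
    qed
    finally show ?thesis by (simp add: algebra_simps)
  qed
  moreover have "c > 0" using B c \<alpha> by (simp add: c_def)
  ultimately show ?thesis by blast
qed

text \<open>The event is covered by three others: a small population in generation \<open>n\<close>,
  a small population in generation \<open>n - k\<close>, and a large population there followed by a
  deviation after \<open>k\<close> generations. The first one contains the case of an empty
  generation \<open>n\<close>.\<close>

lemma prob_composition_deviation:
  assumes z: "M *v z = \<mu> *\<^sub>R z" and \<mu>: "\<bar>\<mu>\<bar> < \<rho>"
  shows "\<exists>B c k. 0 < c \<and> (\<forall>n\<ge>k. prob {\<omega> \<in> space N. \<alpha> \<le> Y \<omega> \<and>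
      (1 \<bullet> rvec (X n \<omega>) = 0 \<or> \<epsilon> * (1 \<bullet> rvec (X n \<omega>)) < \<bar>z \<bullet> rvec (X n \<omega>)\<bar>)}
    \<le> B * exp (- c * \<rho> ^ n))"
proof -
  note [measurable] = Y
  obtain B c\<^sub>0 where B: "B \<ge> 0" "c\<^sub>0 > 0" and small: "\<And>m.
      prob {\<omega> \<in> space N. \<alpha> \<le> Y \<omega> \<and> u \<bullet> rvec (X m \<omega>) < \<alpha> / 4 * \<rho> ^ m} \<le> B * exp (- c\<^sub>0 * \<rho> ^ m)"
    using prob_small_population[OF Y lim b_nonneg \<alpha>] by blast
  obtain c\<^sub>1 k where c\<^sub>1: "c\<^sub>1 > 0" and dev: "\<And>m L. 0 \<le> L \<Longrightarrow> prob {\<omega> \<in> space N. L \<le> u \<bullet> rvec (X m \<omega>) \<and>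
      \<epsilon> * (u \<bullet> rvec (X (m + k) \<omega>)) < \<bar>z \<bullet> rvec (X (m + k) \<omega>)\<bar>} \<le> 2 * exp (real k - c\<^sub>1 * L)"
    using prob_eigenvector_deviation[OF z \<mu> \<epsilon>] by blast
  \<comment> \<open>Two of the bounds decay in \<open>\<rho> ^ (n - k)\<close>; dividing the rates
    by \<open>\<rho> ^ k\<close> expresses them through \<open>\<rho> ^ n\<close>.\<close>
  define c where "c = min (c\<^sub>0 / \<rho> ^ k) (c\<^sub>1 * \<alpha> / 4 / \<rho> ^ k)"
  have rho_pos: "\<rho> ^ n > 0" "\<rho> ^ n \<ge> 1" for n using rho_gt_1 by simp_all
  have c: "c > 0" using B c\<^sub>1 \<alpha> rho_pos by (simp add: c_def)
  have "prob {\<omega> \<in> space N. \<alpha> \<le> Y \<omega> \<and>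
      (1 \<bullet> rvec (X n \<omega>) = 0 \<or> \<epsilon> * (1 \<bullet> rvec (X n \<omega>)) < \<bar>z \<bullet> rvec (X n \<omega>)\<bar>)}
    \<le> (2 * B + 2 * exp (real k)) * exp (- c * \<rho> ^ n)" if "k \<le> n" for n
  proof -
    define m where "m = n - k"
    have n: "n = m + k" using that by (simp add: m_def)
    have "c * \<rho> ^ n \<le> (c\<^sub>0 / \<rho> ^ k) * \<rho> ^ n" "c * \<rho> ^ n \<le> (c\<^sub>1 * \<alpha> / 4 / \<rho> ^ k) * \<rho> ^ n"
      using rho_pos by (intro mult_right_mono; simp add: c_def less_imp_le)+
    then have c_m: "c * \<rho> ^ n \<le> c\<^sub>0 * \<rho> ^ m" "c * \<rho> ^ n \<le> c\<^sub>1 * (\<alpha> / 4 * \<rho> ^ m)"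
      using rho_gt_1 by (simp_all add: n power_add)
    have "c\<^sub>0 * \<rho> ^ m \<le> c\<^sub>0 * \<rho> ^ n"
      using B rho_gt_1 by (intro mult_left_mono power_increasing) (auto simp: n)
    with c_m have c_n: "c * \<rho> ^ n \<le> c\<^sub>0 * \<rho> ^ n" by linarith
    let ?S = "\<lambda>m. {\<omega> \<in> space N. \<alpha> \<le> Y \<omega> \<and> u \<bullet> rvec (X m \<omega>) < \<alpha> / 4 * \<rho> ^ m}"
    let ?A = "{\<omega> \<in> space N. \<alpha> / 4 * \<rho> ^ m \<le> u \<bullet> rvec (X m \<omega>) \<and>
      \<epsilon> * (u \<bullet> rvec (X (m + k) \<omega>)) < \<bar>z \<bullet> rvec (X (m + k) \<omega>)\<bar>}"
    have "prob {\<omega> \<in> space N. \<alpha> \<le> Y \<omega> \<and>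
      (1 \<bullet> rvec (X n \<omega>) = 0 \<or> \<epsilon> * (1 \<bullet> rvec (X n \<omega>)) < \<bar>z \<bullet> rvec (X n \<omega>)\<bar>)}
      \<le> prob (?S n \<union> (?S m \<union> ?A))"
    proof (rule finite_measure_mono)
      have "\<epsilon> * (u \<bullet> rvec (X n \<omega>)) \<le> \<epsilon> * (1 \<bullet> rvec (X n \<omega>))" for \<omega>
        using \<epsilon> u_rvec_le by (intro mult_left_mono) auto
      note le = order.strict_trans1[OF this]
      have zero: "u \<bullet> rvec (X n \<omega>) < \<alpha> / 4 * \<rho> ^ n" if "1 \<bullet> rvec (X n \<omega>) = 0" for \<omega>
      proof -
        have "u \<bullet> rvec (X n \<omega>) \<le> 0" using u_rvec_le[of "X n \<omega>"] that by simp
        also have "0 < \<alpha> / 4 * \<rho> ^ n" using \<alpha> rho_pos by simp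
        finally show ?thesis .
      qed
      show "{\<omega> \<in> space N. \<alpha> \<le> Y \<omega> \<and>
        (1 \<bullet> rvec (X n \<omega>) = 0 \<or> \<epsilon> * (1 \<bullet> rvec (X n \<omega>)) < \<bar>z \<bullet> rvec (X n \<omega>)\<bar>)}
        \<subseteq> ?S n \<union> (?S m \<union> ?A)"
        unfolding n[symmetric] by (auto dest: le zero)
    qed measurable
    also have "\<dots> \<le> prob (?S n) + (prob (?S m) + prob ?A)"
      by (intro order_trans[OF measure_Un_le] add_mono order_refl measure_Un_le) measurable
    also have "\<dots> \<le> B * exp (- c * \<rho> ^ n) + (B * exp (- c * \<rho> ^ n) + 2 * (exp (real k) * exp (- c * \<rho> ^ n)))"
    proof (intro add_mono)
      show "prob (?S n) \<le> B * exp (- c * \<rho> ^ n)"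
        using c_n B by (intro order_trans[OF small] mult_left_mono) auto
      show "prob (?S m) \<le> B * exp (- c * \<rho> ^ n)"
        using c_m B by (intro order_trans[OF small] mult_left_mono) auto
      have "0 \<le> \<alpha> / 4 * \<rho> ^ m" using \<alpha> rho_pos[of m] by simp
      then have "prob ?A \<le> 2 * exp (real k - c\<^sub>1 * (\<alpha> / 4 * \<rho> ^ m))" by (rule dev)
      also have "\<dots> \<le> 2 * (exp (real k) * exp (- c * \<rho> ^ n))"
        using c_m(2) by (simp flip: exp_add)
      finally show "prob ?A \<le> 2 * (exp (real k) * exp (- c * \<rho> ^ n))" .
    qed
    finally show ?thesis by (simp add: algebra_simps)
  qed
  with c show ?thesis by blast
qed

end

end

section \<open>The subdominant eigenvalue and a comparison of rates\<close>

text \<open>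
  In dimension two the vectors orthogonal to \<open>v\<close> form a line, which is therefore spanned by an
  eigenvector; its eigenvalue is the trace minus \<open>\<rho>\<close>.
\<close>

lemma subdominant_eigenvector:
  fixes M :: "real ^ 2 ^ 2" and u v z :: "real ^ 2"
  assumes nonneg: "\<And>i j. 0 \<le> M $ i $ j" and regular: "positively_regular M"
    and left: "v v* M = \<rho> *\<^sub>R v" "\<And>j. v $ j > 0"
    and right: "M *v u = \<rho> *\<^sub>R u" "\<And>j. u $ j > 0"
    and z: "v \<bullet> z = 0"
  shows "\<exists>\<mu>. \<bar>\<mu>\<bar> < \<rho> \<and> M *v z = \<mu> *\<^sub>R z"
proof -
  define \<mu> where "\<mu> = M $ 1 $ 1 + M $ 2 $ 2 - \<rho>"
  have R: "M $ 1 $ 2 * u $ 2 = (\<rho> - M $ 1 $ 1) * u $ 1" "M $ 2 $ 1 * u $ 1 = (\<rho> - M $ 2 $ 2) * u $ 2"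
    using right(1) by (simp_all add: vec_eq_iff forall_2 matrix_vector_mult_def sum_2 algebra_simps)
  have L: "M $ 2 $ 1 * v $ 2 = (\<rho> - M $ 1 $ 1) * v $ 1" "M $ 1 $ 2 * v $ 1 = (\<rho> - M $ 2 $ 2) * v $ 2"
    using left(1) by (simp_all add: vec_eq_iff forall_2 vector_matrix_mult_def sum_2 algebra_simps)
  have z12: "v $ 2 * z $ 2 = - (v $ 1 * z $ 1)"
    using z by (simp add: inner_vec_def sum_2)
  have "v $ 1 * (M $ 1 $ 1 * z $ 1 + M $ 1 $ 2 * z $ 2) = v $ 1 * (\<mu> * z $ 1)"
    using L(2) z12 unfolding \<mu>_def by algebra
  moreover have "v $ 2 * (M $ 2 $ 1 * z $ 1 + M $ 2 $ 2 * z $ 2) = v $ 2 * (\<mu> * z $ 2)"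
    using L(1) z12 unfolding \<mu>_def by algebra
  ultimately have Mz: "M *v z = \<mu> *\<^sub>R z"
    using left(2)[of 1] left(2)[of 2]
    by (simp add: vec_eq_iff forall_2 matrix_vector_mult_def sum_2)
  have diag_le: "M $ 1 $ 1 \<le> \<rho>" "M $ 2 $ 2 \<le> \<rho>"
  proof -
    have "0 \<le> (\<rho> - M $ 1 $ 1) * u $ 1" "0 \<le> (\<rho> - M $ 2 $ 2) * u $ 2"
      using nonneg right(2) by (simp_all flip: R add: less_imp_le)
    then show "M $ 1 $ 1 \<le> \<rho>" "M $ 2 $ 2 \<le> \<rho>"
      using right(2)[of 1] right(2)[of 2] by (simp_all add: zero_le_mult_iff)
  qed
  \<comment> \<open>Diagonal and antidiagonal matrices: all powers of such a matrix are again of one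
    of these two forms and have a zero entry, so positive regularity excludes both.\<close>
  let ?D = "\<lambda>A :: real ^ 2 ^ 2. A $ 1 $ 2 = 0 \<and> A $ 2 $ 1 = 0 \<or> A $ 1 $ 1 = 0 \<and> A $ 2 $ 2 = 0"
  have "\<not> ?D M"
  proof
    assume D: "?D M"
    have "?D (((**) M ^^ k) (mat 1))" for k
      using D by (induction k) (auto simp: mat_def matrix_matrix_mult_def sum_2)
    moreover obtain k where "\<And>i j. (((**) M ^^ k) (mat 1)) $ i $ j > 0"
      using regular by (auto simp: positively_regular_def)
    ultimately show False by (metis less_irrefl)
  qed
  \<comment> \<open>The trace lies between 0 and \<open>2 * \<rho>\<close>, which gives the weak
    inequality. Trace 0 would make \<open>M\<close> antidiagonal, trace \<open>2 * \<rho>\<close>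
    diagonal.\<close>
  have "\<bar>\<mu>\<bar> < \<rho>"
  proof -
    have "M $ 1 $ 1 + M $ 2 $ 2 \<noteq> 0"
      using \<open>\<not> ?D M\<close> nonneg[of 1 1] nonneg[of 2 2] by auto
    moreover have "M $ 1 $ 1 + M $ 2 $ 2 \<noteq> 2 * \<rho>"
    proof
      assume "M $ 1 $ 1 + M $ 2 $ 2 = 2 * \<rho>"
      then have "M $ 1 $ 1 = \<rho>" "M $ 2 $ 2 = \<rho>" using diag_le by auto
      with R right(2)[of 1] right(2)[of 2] have "M $ 1 $ 2 = 0" "M $ 2 $ 1 = 0" by auto
      with \<open>\<not> ?D M\<close> show False by simp
    qed
    ultimately show ?thesis
      using diag_le nonneg[of 1 1] nonneg[of 2 2] by (auto simp: \<mu>_def abs_if)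
  qed
  with Mz show ?thesis by blast
qed

text \<open>With \<open>g = \<rho> powr (1/3)\<close> one has
  \<open>\<rho> ^ n = (g ^ n) ^ 3\<close>, and a cubic in \<open>g ^ n\<close> outgrows any linear
  term. For \<open>P = 0\<close> the quotient is 0, as it is in \<open>cond_prob\<close> given a
  null event.\<close>

lemma eventually_double_exp_le:
  fixes \<rho> A B P c :: real
  assumes "\<rho> > 1" "c > 0" "P \<ge> 0"
  shows "\<forall>\<^sub>F n in sequentially. B * exp (- c * \<rho> ^ n) / P \<le> exp (- (A * (\<rho> powr (1/3)) ^ n))"
proof (cases "P = 0")
  case False
  define g where "g = \<rho> powr (1/3)"
  have g: "g > 1" using assms(1) by (simp add: g_def gr_one_powr)
  have g3: "g ^ 3 = \<rho>" using assms(1) by (simp add: g_def powr_power)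
  have rho: "\<rho> ^ n = (g ^ n) ^ 3" for n
    unfolding g3[symmetric] by (simp only: mult.commute flip: power_mult)
  have "filterlim (\<lambda>x. exp (c * x ^ 3 - A * x)) at_top at_top"
    using assms(2) by real_asymp
  then have "filterlim (\<lambda>n. exp (c * (g ^ n) ^ 3 - A * g ^ n)) at_top sequentially"
    by (rule filterlim_compose) (use g in real_asymp)
  then have "\<forall>\<^sub>F n in sequentially. B / P \<le> exp (c * (g ^ n) ^ 3 - A * g ^ n)"
    by (simp add: filterlim_at_top)
  then show ?thesis
  proof eventually_elim
    case (elim n)
    have "B * exp (- c * \<rho> ^ n) / P = B / P * exp (- c * \<rho> ^ n)" by simp
    also have "\<dots> \<le> exp (c * (g ^ n) ^ 3 - A * g ^ n) * exp (- c * \<rho> ^ n)"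
      using elim by (rule mult_right_mono) simp
    also have "\<dots> = exp (- (A * g ^ n))" by (simp add: rho flip: exp_add)
    finally show ?case by (simp add: g_def)
  qed
qed simp

section \<open>The branching process with immigration\<close>

context two_type_gw_immigration
begin

definition coords :: "coord \<Rightarrow> 'w \<Rightarrow> nat ^ 2"
  where "coords = case_sum (\<lambda>(k, d, t, m). \<xi> k d t m) I"

text \<open>The version of the process that starts surely, not just almost surely, from one particle
  of type \<open>i\<close>; this makes it a function of the independent coordinates.\<close>

definition pop :: "2 \<Rightarrow> nat \<Rightarrow> 'w \<Rightarrow> nat ^ 2"
  where "pop i n \<omega> = population i n (\<lambda>j. coords j \<omega>)"

lemma coords_laws:
  "prob_space.indep_vars (Pr i) (\<lambda>_. count_space UNIV) coords (UNIV <+> {1..})"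
  "distr (Pr i) (count_space UNIV) (coords (Inl (k, d, t, m))) = measure_pmf (p t)"
  "1 \<le> k' \<Longrightarrow> distr (Pr i) (count_space UNIV) (coords (Inr k')) = measure_pmf q"
  using independence offspring_law immigration_law by (simp_all add: coords_def)

lemma measurable_pop: "pop i n \<in> Pr j \<rightarrow>\<^sub>M count_space UNIV"
proof -
  interpret prob_space "Pr j" by (rule prob_space_Pr)
  show ?thesis
    using measurable_population_process[OF coords_laws] unfolding pop_def by simp
qed

lemma AE_pop: "AE \<omega> in Pr i. \<forall>n. gw_immigration Z0 \<xi> I n \<omega> = pop i n \<omega>"
  using start[of i]
proof eventually_elim
  case (elim \<omega>)
  show ?case
  proof
    fix n
    have "lineage i n 0 (\<lambda>j. coords j \<omega>) = descendants (\<xi> 0) Z0 n \<omega>"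
      unfolding lineage_def diff_zero using elim by (intro descendants_cong) (auto simp: coords_def)
    moreover have "lineage i n k (\<lambda>j. coords j \<omega>) = descendants (\<xi> k) (I k) (n - k) \<omega>" if "1 \<le> k" for k
      unfolding lineage_def using that by (intro descendants_cong) (auto simp: coords_def)
    moreover have "{..n} = insert 0 {1..n}" by auto
    ultimately show "gw_immigration Z0 \<xi> I n \<omega> = pop i n \<omega>"
      by (simp add: gw_immigration_def pop_def population_def)
  qed
qed

context
  fixes \<theta>\<^sub>0 :: real
  assumes \<theta>\<^sub>0: "\<theta>\<^sub>0 > 0"
    and exp_moment: "\<And>i. integrable (Pr i)
      (\<lambda>\<omega>. exp (\<theta>\<^sub>0 * (1 \<bullet> rvec (gw_immigration Z0 \<xi> I 1 \<omega>))))"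
begin

text \<open>Started from one particle of type \<open>t\<close>, the first generation is almost
  surely the sum of one offspring vector of law \<open>p t\<close> and one immigration of law
  \<open>q\<close>. Both are nonnegative, so each inherits the exponential moment of the
  sum.\<close>

lemma exp_moment_laws:
  "integrable (p t) (\<lambda>j. exp (\<theta>\<^sub>0 * (1 \<bullet> rvec j)))"
  "integrable q (\<lambda>j. exp (\<theta>\<^sub>0 * (1 \<bullet> rvec j)))"
proof -
  interpret prob_space "Pr t" by (rule prob_space_Pr)
  let ?e = "\<lambda>x. exp (\<theta>\<^sub>0 * (1 \<bullet> rvec x))"
  have X1: "AE \<omega> in Pr t. gw_immigration Z0 \<xi> I 1 \<omega> = \<xi> 0 0 t 0 \<omega> + I 1 \<omega>"
    using start[of t]
  proof eventually_elim
    case (elim \<omega>)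
    have "(\<Sum>s\<in>UNIV. \<Sum>m<(axis t 1 :: nat ^ 2) $ s. \<xi> 0 0 s m \<omega>)
        = (\<Sum>s\<in>UNIV. if s = t then \<xi> 0 0 t 0 \<omega> else 0)"
      by (intro sum.cong) (auto simp: axis_def)
    then show ?case using elim by (simp add: gw_immigration_def)
  qed
  have dominated: "integrable r ?e"
    if "j \<in> UNIV <+> {1..}" "distr (Pr t) (count_space UNIV) (coords j) = measure_pmf r"
      and le: "AE \<omega> in Pr t. ?e (coords j \<omega>) \<le> ?e (gw_immigration Z0 \<xi> I 1 \<omega>)" for r j
  proof -
    have meas: "coords j \<in> Pr t \<rightarrow>\<^sub>M count_space UNIV"
      by (rule measurable_coords[OF coords_laws that(1)])
    have "integrable (Pr t) (\<lambda>\<omega>. ?e (coords j \<omega>))"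
    proof (rule Bochner_Integration.integrable_bound[OF exp_moment])
      show "(\<lambda>\<omega>. ?e (coords j \<omega>)) \<in> borel_measurable (Pr t)"
        by (rule measurable_compose[OF meas]) simp
    qed (use le in simp)
    then show ?thesis
      unfolding that(2)[symmetric] using meas by (subst integrable_distr_eq) auto
  qed
  show "integrable (p t) ?e"
  proof (rule dominated[OF _ coords_laws(2)])
    show "AE \<omega> in Pr t. ?e (coords (Inl (0, 0, t, 0)) \<omega>) \<le> ?e (gw_immigration Z0 \<xi> I 1 \<omega>)"
      using X1
    proof eventually_elim
      case (elim \<omega>)
      show ?case
        unfolding elim using \<theta>\<^sub>0 inner_one_rvec_nonneg by (simp add: coords_def rvec_add inner_add_right)
    qed
  qed auto
  show "integrable q ?e"
  proof (rule dominated[OF _ coords_laws(3)])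
    show "AE \<omega> in Pr t. ?e (coords (Inr 1) \<omega>) \<le> ?e (gw_immigration Z0 \<xi> I 1 \<omega>)"
      using X1
    proof eventually_elim
      case (elim \<omega>)
      show ?case
        unfolding elim using \<theta>\<^sub>0 inner_one_rvec_nonneg by (simp add: coords_def rvec_add inner_add_right)
    qed
  qed auto
qed

lemma mean_matrix_nonneg:
  assumes "is_mean_matrix p M"
  shows "0 \<le> M $ i $ j"
proof -
  have int: "integrable (p i) rvec" by (rule integrable_rvec[OF \<theta>\<^sub>0 exp_moment_laws(1)])
  have "M $ i $ j = measure_pmf.expectation (p i) rvec \<bullet> axis j 1"
    using mean_matrix_row[OF assms int] by (simp add: inner_axis)
  also have "\<dots> = measure_pmf.expectation (p i) (\<lambda>x. rvec x \<bullet> axis j 1)"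
    using int by (subst integral_inner_left) auto
  also have "\<dots> \<ge> 0" by (intro Bochner_Integration.integral_nonneg) (simp add: inner_axis)
  finally show ?thesis .
qed

text \<open>Since \<open>u\<close> is strictly positive, the errors
  \<open>c t * (norm w)\<^sup>2\<close> of the two types fit below a common multiple of
  \<open>u\<close>; hence the quotients \<open>c t / u $ t\<close> in \<open>C\<close>. The
  immigration exponent is linear in \<open>norm w\<close> on the ball of radius \<open>r\<close>,
  with slope at most \<open>norm m + c' * r\<close>. The constants come from \<open>p\<close> and
  \<open>q\<close> only and so serve both initial types.\<close>

lemma exponential_drift_pop:
  assumes mean: "is_mean_matrix p M" and u: "\<And>j. u $ j > 0" "u \<bullet> 1 = 1"
    and right: "M *v u = \<rho> *\<^sub>R u" and \<rho>: "\<rho> > 1"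
  shows "\<exists>C r. \<forall>i. exponential_drift (Pr i) (pop i) M u \<rho> C r"
proof -
  define r where "r = \<theta>\<^sub>0 / 2"
  have r: "r > 0" using \<theta>\<^sub>0 by (simp add: r_def)
  have "\<exists>c\<ge>0. \<forall>w. norm w \<le> r \<longrightarrow> (\<integral>\<^sup>+j. ennreal (exp (w \<bullet> rvec j)) \<partial>p t)
      \<le> ennreal (exp (w \<bullet> M $ t + c * (norm w)\<^sup>2))" for t
    using mgf_quadratic_bound[OF \<theta>\<^sub>0 exp_moment_laws(1)[of t]]
      mean_matrix_row[OF mean integrable_rvec[OF \<theta>\<^sub>0 exp_moment_laws(1)], of t]
    by (simp add: r_def)
  then obtain c where c: "\<And>t. c t \<ge> 0" and mgf_p: "\<And>t w. norm w \<le> r \<Longrightarrow>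
      (\<integral>\<^sup>+j. ennreal (exp (w \<bullet> rvec j)) \<partial>p t) \<le> ennreal (exp (w \<bullet> M $ t + c t * (norm w)\<^sup>2))"
    by metis
  define m where "m = measure_pmf.expectation q rvec"
  obtain c' where c': "c' \<ge> 0" and mgf_q: "\<And>w. norm w \<le> r \<Longrightarrow>
      (\<integral>\<^sup>+j. ennreal (exp (w \<bullet> rvec j)) \<partial>q) \<le> ennreal (exp (w \<bullet> m + c' * (norm w)\<^sup>2))"
    using mgf_quadratic_bound[OF \<theta>\<^sub>0 exp_moment_laws(2)] by (auto simp: r_def m_def)
  define C where "C = (\<Sum>t\<in>UNIV. c t / u $ t) + (norm m + c' * r)"
  have sum_nonneg: "0 \<le> (\<Sum>t\<in>UNIV. c t / u $ t)" "0 \<le> norm m + c' * r"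
    using c c' r u(1) by (auto intro!: sum_nonneg add_nonneg_nonneg simp: less_imp_le)
  have C: "C \<ge> 0" using sum_nonneg by (simp add: C_def)
  have C_u: "c t \<le> C * u $ t" for t
  proof -
    have "c t / u $ t \<le> (\<Sum>t\<in>UNIV. c t / u $ t)"
      using c u(1) by (intro member_le_sum) (auto simp: less_imp_le)
    then have "c t / u $ t \<le> C" using sum_nonneg by (simp add: C_def)
    then show ?thesis using u(1)[of t] by (simp add: field_simps)
  qed
  have C_w: "w \<bullet> m + c' * (norm w)\<^sup>2 \<le> C * norm w" if "norm w \<le> r" for w
  proof -
    have "w \<bullet> m \<le> norm m * norm w" using norm_cauchy_schwarz[of w m] by (simp add: mult.commute)
    moreover have "c' * norm w * norm w \<le> c' * r * norm w"
      using that c' by (intro mult_right_mono mult_left_mono) auto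
    moreover have "(norm m + c' * r) * norm w \<le> C * norm w"
      using sum_nonneg by (intro mult_right_mono) (auto simp: C_def)
    ultimately show ?thesis by (simp add: power2_eq_square algebra_simps)
  qed
  have "exponential_drift (Pr i) (pop i) M u \<rho> C r" for i
  proof -
    interpret prob_space "Pr i" by (rule prob_space_Pr)
    show ?thesis
    proof
      fix w :: "real ^ 2" and m' n :: nat and h :: "nat ^ 2 \<Rightarrow> ennreal"
      assume w: "norm w \<le> r" and mn: "m' \<le> n"
      define a where "a = (\<chi> t. w \<bullet> M $ t + c t * (norm w)\<^sup>2)"
      have "(\<integral>\<^sup>+\<omega>. h (pop i m' \<omega>) * ennreal (exp (w \<bullet> rvec (pop i (Suc n) \<omega>))) \<partial>Pr i)
        \<le> (\<integral>\<^sup>+\<omega>. h (pop i m' \<omega>) *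
            ennreal (exp (a \<bullet> rvec (pop i n \<omega>) + (w \<bullet> m + c' * (norm w)\<^sup>2))) \<partial>Pr i)"
        unfolding pop_def
        by (rule nn_integral_exp_step[OF coords_laws _ mgf_q[OF w] mn])
           (use mgf_p[OF w] in \<open>simp_all add: a_def\<close>)
      also have "\<dots> \<le> (\<integral>\<^sup>+\<omega>. h (pop i m' \<omega>) *
          ennreal (exp ((M *v w + (C * (norm w)\<^sup>2) *\<^sub>R u) \<bullet> rvec (pop i n \<omega>) + C * norm w)) \<partial>Pr i)"
      proof (intro nn_integral_mono mult_left_mono ennreal_leI exp_le_cancel_iff[THEN iffD2]
          add_mono inner_rvec_mono C_w w)
        fix t
        have "c t * (norm w)\<^sup>2 \<le> C * u $ t * (norm w)\<^sup>2"
          by (intro mult_right_mono C_u) simp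
        then show "a $ t \<le> (M *v w + (C * (norm w)\<^sup>2) *\<^sub>R u) $ t"
          by (simp add: a_def matrix_vector_mul_component inner_commute mult_ac)
      qed auto
      finally show "(\<integral>\<^sup>+\<omega>. h (pop i m' \<omega>) * ennreal (exp (w \<bullet> rvec (pop i (Suc n) \<omega>))) \<partial>Pr i)
        \<le> (\<integral>\<^sup>+\<omega>. h (pop i m' \<omega>) *
          ennreal (exp ((M *v w + (C * (norm w)\<^sup>2) *\<^sub>R u) \<bullet> rvec (pop i n \<omega>) + C * norm w)) \<partial>Pr i)" .
    qed (use measurable_pop \<rho> right u C r in auto)
  qed
  then show ?thesis by blast
qed

end

end

section \<open>Assembly of the two conditional estimates\<close>

lemma (in prob_space) cond_prob_le_1: "{\<omega> \<in> space M. Q \<omega>} \<in> events \<Longrightarrow> cond_prob M P Q \<le> 1"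
  unfolding cond_prob_def
  by (intro divide_le_eq_1[THEN iffD2])
     (auto intro!: finite_measure_mono simp: zero_less_measure_iff less_le)

theorem theorem1p6:
  fixes p :: "2 \<Rightarrow> (nat ^ 2) pmf"
    and q :: "(nat ^ 2) pmf"
    and Pr :: "2 \<Rightarrow> 'w measure"
    and Z0 :: "'w \<Rightarrow> nat ^ 2"
    and \<xi> :: "nat \<Rightarrow> nat \<Rightarrow> 2 \<Rightarrow> nat \<Rightarrow> 'w \<Rightarrow> nat ^ 2"
    and I :: "nat \<Rightarrow> 'w \<Rightarrow> nat ^ 2"
    and X :: "nat \<Rightarrow> 'w \<Rightarrow> real ^ 2"
    and Y :: "'w \<Rightarrow> real"
    and M :: "real ^ 2 ^ 2"
    and \<rho> \<theta>\<^sub>0 :: real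
    and u v lam :: "real ^ 2"
  assumes process: "two_type_gw_immigration p q Pr Z0 \<xi> I"
    and X: "X = (\<lambda>n \<omega>. rvec (gw_immigration Z0 \<xi> I n \<omega>))"
    and no_death: "offspring_gf p 0 = 0"
    and mean: "is_mean_matrix p M"
    and regular: "positively_regular M"
    and rho: "maximal_eigenvalue M \<rho>" "\<rho> > 1"
    and left_ev: "v v* M = \<rho> *\<^sub>R v" "\<And>j. v $ j > 0"
    and right_ev: "M *v u = \<rho> *\<^sub>R u" "\<And>j. u $ j > 0"
    and normalization: "v \<bullet> u = 1" "u \<bullet> 1 = 1"
    and lam: "lam = measure_pmf.expectation q rvec"
    and Y_measurable: "\<And>i. Y \<in> borel_measurable (Pr i)"
    and Y_limit: "\<And>i. AE \<omega> in Pr i.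
      (\<lambda>n. (u \<bullet> X n \<omega> - (\<rho> ^ (n + 1) - 1) / (\<rho> - 1) * (u \<bullet> lam)) / \<rho> ^ n)
        \<longlonglongrightarrow> Y \<omega>"
    and exp_moment: "\<theta>\<^sub>0 > 0" "\<And>i. integrable (Pr i) (\<lambda>\<omega>. exp (\<theta>\<^sub>0 * (1 \<bullet> X 1 \<omega>)))"
  shows "\<exists>C\<^sub>5 > 0. \<exists>C\<^sub>6 > 0. \<exists>C\<^sub>7 > 0. \<exists>C\<^sub>8 > 0. \<exists>\<kappa>\<^sub>2 > 0. \<exists>\<kappa>\<^sub>3 > 0.
    \<forall>\<epsilon> > 0. \<forall>\<alpha> > 0. \<forall>l :: real ^ 2. l \<noteq> 0 \<longrightarrow>
      (\<exists>\<Lambda> > 0. \<forall>i. \<forall>n \<ge> 1. \<forall>\<beta>. 0 < \<beta> \<and> \<beta> < 1 \<longrightarrow>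
        cond_prob (Pr i)
            (\<lambda>\<omega>. \<bar>(l \<bullet> X (n + 1) \<omega>) / (1 \<bullet> X n \<omega>) - (l \<bullet> (X n \<omega> v* M)) / (1 \<bullet> X n \<omega>)\<bar> > \<epsilon>)
            (\<lambda>\<omega>. Y \<omega> \<ge> \<alpha>)
          \<le> C\<^sub>5 * exp (- (\<alpha> * \<beta> * \<Lambda> * \<rho> ^ n))
            + C\<^sub>6 * exp (- (\<kappa>\<^sub>2 * (\<alpha> * (1 - \<beta>)) powr (2/3) * (\<rho> powr (1/3)) ^ n)) \<and>
        cond_prob (Pr i)
            (\<lambda>\<omega>. \<bar>(l \<bullet> X n \<omega>) / (1 \<bullet> X n \<omega>) - (l \<bullet> v) / (1 \<bullet> v)\<bar> > \<epsilon>)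
            (\<lambda>\<omega>. Y \<omega> \<ge> \<alpha>)
          \<le> C\<^sub>7 * exp (- (\<alpha> * \<beta> * \<Lambda> * \<rho> ^ n))
            + C\<^sub>8 * exp (- (\<kappa>\<^sub>3 * (\<alpha> * (1 - \<beta>)) powr (2/3) * (\<rho> powr (1/3)) ^ n)))"
proof -
  interpret two_type_gw_immigration p q Pr Z0 \<xi> I by (rule process)
  have moment: "integrable (Pr i) (\<lambda>\<omega>. exp (\<theta>\<^sub>0 * (1 \<bullet> rvec (gw_immigration Z0 \<xi> I 1 \<omega>))))" for i
    using exp_moment(2)[of i] by (simp add: X)
  obtain C r where drift: "\<And>i. exponential_drift (Pr i) (pop i) M u \<rho> C r"
    using exponential_drift_pop[OF exp_moment(1) moment mean right_ev(2) normalization(2) right_ev(1) rho(2)]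
    by blast
  have X_pop: "AE \<omega> in Pr i. \<forall>n. X n \<omega> = rvec (pop i n \<omega>)" for i
    using AE_pop[of i] by eventually_elim (simp add: X)
  define b where "b n = (\<rho> ^ (n + 1) - 1) / (\<rho> - 1) * (u \<bullet> lam)" for n
  have "0 \<le> u \<bullet> lam"
  proof -
    have int: "integrable q rvec"
      by (rule integrable_rvec[OF exp_moment(1) exp_moment_laws(2)[OF exp_moment(1) moment]])
    have "u \<bullet> lam = measure_pmf.expectation q (\<lambda>x. u \<bullet> rvec x)"
      using int unfolding lam by (subst integral_inner_right) auto
    also have "\<dots> \<ge> 0"
      using right_ev(2) by (auto simp: inner_vec_def less_imp_le intro!: Bochner_Integration.integral_nonneg sum_nonneg)
    finally show ?thesis .
  qed
  then have b: "0 \<le> b n" for n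
    using rho(2) one_le_power[of \<rho> "n + 1"] unfolding b_def
    by (intro mult_nonneg_nonneg divide_nonneg_nonneg) auto
  have Y_pop: "AE \<omega> in Pr i. (\<lambda>n. (u \<bullet> rvec (pop i n \<omega>) - b n) / \<rho> ^ n) \<longlonglongrightarrow> Y \<omega>" for i
    using X_pop[of i] Y_limit[of i] by eventually_elim (simp add: b_def)
  \<comment> \<open>The rate belonging to \<open>\<beta> = 0\<close>. It is at least
    \<open>(\<alpha> * (1 - \<beta>)) powr (2/3)\<close>, so a single asymptotic bound serves every
    \<open>\<beta>\<close>.\<close>
  let ?A = "\<lambda>\<alpha>. \<alpha> powr (2/3)"
  have dev1: "\<forall>\<^sub>F n in sequentially. cond_prob (Pr i)
      (\<lambda>\<omega>. \<bar>(l \<bullet> X (n + 1) \<omega>) / (1 \<bullet> X n \<omega>) - (l \<bullet> (X n \<omega> v* M)) / (1 \<bullet> X n \<omega>)\<bar> > \<epsilon>)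
      (\<lambda>\<omega>. Y \<omega> \<ge> \<alpha>) \<le> exp (- (?A \<alpha> * (\<rho> powr (1/3)) ^ n))"
    if \<epsilon>: "\<epsilon> > 0" and \<alpha>: "\<alpha> > 0" for \<epsilon> \<alpha> i l
  proof -
    interpret D: exponential_drift "Pr i" "pop i" M u \<rho> C r by (rule drift)
    obtain B c where c: "0 < c" and bound: "\<And>n. measure (Pr i) {\<omega> \<in> space (Pr i). \<alpha> \<le> Y \<omega> \<and>
        \<epsilon> * (1 \<bullet> rvec (pop i n \<omega>)) < \<bar>l \<bullet> rvec (pop i (Suc n) \<omega>) - (M *v l) \<bullet> rvec (pop i n \<omega>)\<bar>}
        \<le> B * exp (- c * \<rho> ^ n)"
      using D.prob_offspring_deviation[OF Y_measurable Y_pop b \<alpha> \<epsilon>] by blast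
    \<comment> \<open>The probability of the conditioning event does not depend on \<open>n\<close>,
      so dividing by it only alters the constant in front of the doubly exponential bound.\<close>
    have "\<forall>\<^sub>F n in sequentially. B * exp (- c * \<rho> ^ n) / measure (Pr i) {\<omega> \<in> space (Pr i). Y \<omega> \<ge> \<alpha>}
        \<le> exp (- (?A \<alpha> * (\<rho> powr (1/3)) ^ n))"
      by (rule eventually_double_exp_le[OF rho(2) c measure_nonneg])
    then show ?thesis
    proof eventually_elim
      case (elim n)
      note [measurable] = Y_measurable D.measurable_inner_X
      have "measure (Pr i) {\<omega> \<in> space (Pr i).
          \<bar>(l \<bullet> X (n + 1) \<omega>) / (1 \<bullet> X n \<omega>) - (l \<bullet> (X n \<omega> v* M)) / (1 \<bullet> X n \<omega>)\<bar> > \<epsilon> \<and> Y \<omega> \<ge> \<alpha>}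
        \<le> measure (Pr i) {\<omega> \<in> space (Pr i). \<alpha> \<le> Y \<omega> \<and>
        \<epsilon> * (1 \<bullet> rvec (pop i n \<omega>)) < \<bar>l \<bullet> rvec (pop i (Suc n) \<omega>) - (M *v l) \<bullet> rvec (pop i n \<omega>)\<bar>}"
      proof (rule D.finite_measure_mono_AE)
        show "AE \<omega> in Pr i. \<omega> \<in> {\<omega> \<in> space (Pr i).
          \<bar>(l \<bullet> X (n + 1) \<omega>) / (1 \<bullet> X n \<omega>) - (l \<bullet> (X n \<omega> v* M)) / (1 \<bullet> X n \<omega>)\<bar> > \<epsilon> \<and> Y \<omega> \<ge> \<alpha>}
          \<longrightarrow> \<omega> \<in> {\<omega> \<in> space (Pr i). \<alpha> \<le> Y \<omega> \<and>
        \<epsilon> * (1 \<bullet> rvec (pop i n \<omega>)) < \<bar>l \<bullet> rvec (pop i (Suc n) \<omega>) - (M *v l) \<bullet> rvec (pop i n \<omega>)\<bar>}"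
          using X_pop[of i]
        proof eventually_elim
          case (elim \<omega>)
          let ?s = "1 \<bullet> rvec (pop i n \<omega>)"
          have "\<epsilon> * ?s < \<bar>x - y\<bar>" if "\<epsilon> < \<bar>x / ?s - y / ?s\<bar>" for x y
          proof -
            \<comment> \<open>In an empty population both quotients have the value 0, and there is
              no deviation.\<close>
            have "?s \<noteq> 0" using that \<epsilon> by auto
            then have "?s > 0" using inner_one_rvec_nonneg[of "pop i n \<omega>"] by simp
            with that show ?thesis
              by (simp add: abs_divide pos_less_divide_eq flip: diff_divide_distrib)
          qed
          moreover have "l \<bullet> (X n \<omega> v* M) = (M *v l) \<bullet> rvec (pop i n \<omega>)"
            using dot_lmul_matrix[of "X n \<omega>" M l] elim by (simp add: inner_commute)
          ultimately show ?case using elim by auto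
        qed
      qed measurable
      also note bound
      finally show ?case
        unfolding cond_prob_def
        by (rule order_trans[OF divide_right_mono[OF _ measure_nonneg] elim])
    qed
  qed
  have dev2: "\<forall>\<^sub>F n in sequentially. cond_prob (Pr i)
      (\<lambda>\<omega>. \<bar>(l \<bullet> X n \<omega>) / (1 \<bullet> X n \<omega>) - (l \<bullet> v) / (1 \<bullet> v)\<bar> > \<epsilon>)
      (\<lambda>\<omega>. Y \<omega> \<ge> \<alpha>) \<le> exp (- (?A \<alpha> * (\<rho> powr (1/3)) ^ n))"
    if \<epsilon>: "\<epsilon> > 0" and \<alpha>: "\<alpha> > 0" for \<epsilon> \<alpha> i l
  proof -
    interpret D: exponential_drift "Pr i" "pop i" M u \<rho> C r by (rule drift)
    \<comment> \<open>Subtracting this multiple of 1 makes \<open>z\<close> orthogonal to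
      \<open>v\<close>, and \<open>(z \<bullet> x) / (1 \<bullet> x)\<close> is exactly the
      difference of the two ratios whenever \<open>1 \<bullet> x \<noteq> 0\<close>.\<close>
    define z where "z = l - ((l \<bullet> v) / (1 \<bullet> v)) *\<^sub>R 1"
    have "1 \<bullet> v > 0"
      using left_ev(2)[of 1] left_ev(2)[of 2] by (simp add: inner_vec_def sum_2)
    then have "v \<bullet> z = 0" by (simp add: z_def inner_diff_right inner_commute)
    then obtain \<mu> where \<mu>: "\<bar>\<mu>\<bar> < \<rho>" "M *v z = \<mu> *\<^sub>R z"
      using subdominant_eigenvector[OF mean_matrix_nonneg[OF exp_moment(1) moment mean] regular
          left_ev right_ev] by blast
    obtain B c k where c: "0 < c" and bound: "\<And>n. k \<le> n \<Longrightarrow> measure (Pr i) {\<omega> \<in> space (Pr i). \<alpha> \<le> Y \<omega> \<and>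
        (1 \<bullet> rvec (pop i n \<omega>) = 0 \<or> \<epsilon> * (1 \<bullet> rvec (pop i n \<omega>)) < \<bar>z \<bullet> rvec (pop i n \<omega>)\<bar>)}
        \<le> B * exp (- c * \<rho> ^ n)"
      using D.prob_composition_deviation[OF Y_measurable Y_pop b \<alpha> \<epsilon> \<mu>(2,1)] by blast
    have "\<forall>\<^sub>F n in sequentially. B * exp (- c * \<rho> ^ n) / measure (Pr i) {\<omega> \<in> space (Pr i). Y \<omega> \<ge> \<alpha>}
        \<le> exp (- (?A \<alpha> * (\<rho> powr (1/3)) ^ n))"
      by (rule eventually_double_exp_le[OF rho(2) c measure_nonneg])
    then show ?thesis
      using eventually_ge_at_top[of k]
    proof eventually_elim
      case (elim n)
      note [measurable] = Y_measurable D.measurable_inner_X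
      have "measure (Pr i) {\<omega> \<in> space (Pr i).
          \<bar>(l \<bullet> X n \<omega>) / (1 \<bullet> X n \<omega>) - (l \<bullet> v) / (1 \<bullet> v)\<bar> > \<epsilon> \<and> Y \<omega> \<ge> \<alpha>}
        \<le> measure (Pr i) {\<omega> \<in> space (Pr i). \<alpha> \<le> Y \<omega> \<and>
        (1 \<bullet> rvec (pop i n \<omega>) = 0 \<or> \<epsilon> * (1 \<bullet> rvec (pop i n \<omega>)) < \<bar>z \<bullet> rvec (pop i n \<omega>)\<bar>)}"
      proof (rule D.finite_measure_mono_AE)
        show "AE \<omega> in Pr i. \<omega> \<in> {\<omega> \<in> space (Pr i).
          \<bar>(l \<bullet> X n \<omega>) / (1 \<bullet> X n \<omega>) - (l \<bullet> v) / (1 \<bullet> v)\<bar> > \<epsilon> \<and> Y \<omega> \<ge> \<alpha>}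
          \<longrightarrow> \<omega> \<in> {\<omega> \<in> space (Pr i). \<alpha> \<le> Y \<omega> \<and>
        (1 \<bullet> rvec (pop i n \<omega>) = 0 \<or> \<epsilon> * (1 \<bullet> rvec (pop i n \<omega>)) < \<bar>z \<bullet> rvec (pop i n \<omega>)\<bar>)}"
          using X_pop[of i]
        proof eventually_elim
          case (elim \<omega>)
          let ?x = "rvec (pop i n \<omega>)"
          \<comment> \<open>In an empty population the first ratio is 0 and may well deviate from
            the limit; that case is the other alternative of the bounding event.\<close>
          have "\<epsilon> * (1 \<bullet> ?x) < \<bar>z \<bullet> ?x\<bar>"
            if less: "\<epsilon> < \<bar>(l \<bullet> ?x) / (1 \<bullet> ?x) - (l \<bullet> v) / (1 \<bullet> v)\<bar>" and "1 \<bullet> ?x \<noteq> 0"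
          proof -
            have pos: "1 \<bullet> ?x > 0" using that(2) inner_one_rvec_nonneg[of "pop i n \<omega>"] by simp
            then have "(l \<bullet> ?x) / (1 \<bullet> ?x) - (l \<bullet> v) / (1 \<bullet> v) = (z \<bullet> ?x) / (1 \<bullet> ?x)"
              by (simp add: z_def inner_diff_left diff_divide_distrib)
            with less pos show ?thesis by (simp add: abs_divide pos_less_divide_eq)
          qed
          then show ?case using elim by auto
        qed
      qed measurable
      also note bound[OF elim(2)]
      finally show ?case
        unfolding cond_prob_def
        by (rule order_trans[OF divide_right_mono[OF _ measure_nonneg] elim(1)])
    qed
  qed
  have le_1: "cond_prob (Pr i) P (\<lambda>\<omega>. Y \<omega> \<ge> \<alpha>) \<le> 1" for i P \<alpha>
  proof -
    interpret prob_space "Pr i" by (rule prob_space_Pr)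
    note [measurable] = Y_measurable
    show ?thesis by (rule cond_prob_le_1) measurable
  qed
  text \<open>
    The scale \<open>\<Lambda>\<close> may depend on \<open>\<alpha>\<close>: choosing it small makes the first term exceed 1 for the
    finitely many \<open>n\<close> that the asymptotic bounds do not cover.
  \<close>
  have combine: "P \<le> exp 1 * exp (- (\<alpha> * \<beta> * (1 / (\<alpha> * \<rho> ^ N)) * \<rho> ^ n))
      + 1 * exp (- (1 * (\<alpha> * (1 - \<beta>)) powr (2/3) * (\<rho> powr (1/3)) ^ n))"
    if \<alpha>: "\<alpha> > 0" and \<beta>: "0 < \<beta>" "\<beta> < 1" and P: "P \<le> 1"
      and large: "N \<le> n \<Longrightarrow> P \<le> exp (- (?A \<alpha> * (\<rho> powr (1/3)) ^ n))" for P \<alpha> \<beta> :: real and N n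
  proof (cases "N \<le> n")
    case True
    have "(\<alpha> * (1 - \<beta>)) powr (2/3) \<le> ?A \<alpha>"
      using \<alpha> \<beta> by (intro powr_mono2) (auto intro: mult_left_le)
    then have "(\<alpha> * (1 - \<beta>)) powr (2/3) * (\<rho> powr (1/3)) ^ n \<le> ?A \<alpha> * (\<rho> powr (1/3)) ^ n"
      by (rule mult_right_mono) simp
    then have "P \<le> exp (- ((\<alpha> * (1 - \<beta>)) powr (2/3) * (\<rho> powr (1/3)) ^ n))"
      by (intro order_trans[OF large[OF True]]) simp
    then show ?thesis by (simp add: add_increasing)
  next
    case False
    \<comment> \<open>With \<open>1 / (\<alpha> * \<rho> ^ N)\<close> as \<open>\<Lambda>\<close>,
      the first exponent equals \<open>- \<beta> * \<rho> ^ n / \<rho> ^ N\<close>, which is at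
      least \<open>- 1\<close>; the prefactor \<open>exp 1\<close> makes up for it.\<close>
    then have "\<rho> ^ n / \<rho> ^ N \<le> 1" using rho(2) by (simp add: power_increasing)
    then have "\<beta> * (\<rho> ^ n / \<rho> ^ N) \<le> 1 * 1"
      using \<beta> rho(2) by (intro mult_mono) auto
    then have "\<alpha> * \<beta> * (1 / (\<alpha> * \<rho> ^ N)) * \<rho> ^ n \<le> 1" using \<alpha> by simp
    then have "1 \<le> exp 1 * exp (- (\<alpha> * \<beta> * (1 / (\<alpha> * \<rho> ^ N)) * \<rho> ^ n))"
      by (simp flip: exp_add)
    with P have "P \<le> exp 1 * exp (- (\<alpha> * \<beta> * (1 / (\<alpha> * \<rho> ^ N)) * \<rho> ^ n))" by linarith
    then show ?thesis by (simp add: add_increasing2)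
  qed
  have main: "\<exists>\<Lambda>>0. \<forall>i. \<forall>n\<ge>1. \<forall>\<beta>. 0 < \<beta> \<and> \<beta> < 1 \<longrightarrow>
        cond_prob (Pr i)
            (\<lambda>\<omega>. \<bar>(l \<bullet> X (n + 1) \<omega>) / (1 \<bullet> X n \<omega>) - (l \<bullet> (X n \<omega> v* M)) / (1 \<bullet> X n \<omega>)\<bar> > \<epsilon>)
            (\<lambda>\<omega>. Y \<omega> \<ge> \<alpha>)
          \<le> exp 1 * exp (- (\<alpha> * \<beta> * \<Lambda> * \<rho> ^ n))
            + 1 * exp (- (1 * (\<alpha> * (1 - \<beta>)) powr (2/3) * (\<rho> powr (1/3)) ^ n)) \<and>
        cond_prob (Pr i)
            (\<lambda>\<omega>. \<bar>(l \<bullet> X n \<omega>) / (1 \<bullet> X n \<omega>) - (l \<bullet> v) / (1 \<bullet> v)\<bar> > \<epsilon>)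
            (\<lambda>\<omega>. Y \<omega> \<ge> \<alpha>)
          \<le> exp 1 * exp (- (\<alpha> * \<beta> * \<Lambda> * \<rho> ^ n))
            + 1 * exp (- (1 * (\<alpha> * (1 - \<beta>)) powr (2/3) * (\<rho> powr (1/3)) ^ n))"
    if \<epsilon>: "\<epsilon> > 0" and \<alpha>: "\<alpha> > 0" for \<epsilon> \<alpha> l
  proof -
    \<comment> \<open>There are only two initial types and two estimates, so one \<open>N\<close>
      works for all of them.\<close>
    have "\<forall>\<^sub>F n in sequentially. \<forall>i.
        cond_prob (Pr i)
            (\<lambda>\<omega>. \<bar>(l \<bullet> X (n + 1) \<omega>) / (1 \<bullet> X n \<omega>) - (l \<bullet> (X n \<omega> v* M)) / (1 \<bullet> X n \<omega>)\<bar> > \<epsilon>)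
            (\<lambda>\<omega>. Y \<omega> \<ge> \<alpha>) \<le> exp (- (?A \<alpha> * (\<rho> powr (1/3)) ^ n)) \<and>
        cond_prob (Pr i)
            (\<lambda>\<omega>. \<bar>(l \<bullet> X n \<omega>) / (1 \<bullet> X n \<omega>) - (l \<bullet> v) / (1 \<bullet> v)\<bar> > \<epsilon>)
            (\<lambda>\<omega>. Y \<omega> \<ge> \<alpha>) \<le> exp (- (?A \<alpha> * (\<rho> powr (1/3)) ^ n))"
      using dev1[OF \<epsilon> \<alpha>] dev2[OF \<epsilon> \<alpha>] by (intro eventually_all_finite eventually_conj)
    then obtain N where N: "\<And>n i. N \<le> n \<Longrightarrow>
        cond_prob (Pr i)
            (\<lambda>\<omega>. \<bar>(l \<bullet> X (n + 1) \<omega>) / (1 \<bullet> X n \<omega>) - (l \<bullet> (X n \<omega> v* M)) / (1 \<bullet> X n \<omega>)\<bar> > \<epsilon>)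
            (\<lambda>\<omega>. Y \<omega> \<ge> \<alpha>) \<le> exp (- (?A \<alpha> * (\<rho> powr (1/3)) ^ n)) \<and>
        cond_prob (Pr i)
            (\<lambda>\<omega>. \<bar>(l \<bullet> X n \<omega>) / (1 \<bullet> X n \<omega>) - (l \<bullet> v) / (1 \<bullet> v)\<bar> > \<epsilon>)
            (\<lambda>\<omega>. Y \<omega> \<ge> \<alpha>) \<le> exp (- (?A \<alpha> * (\<rho> powr (1/3)) ^ n))"
      by (auto simp: eventually_sequentially)
    have "1 / (\<alpha> * \<rho> ^ N) > 0" using \<alpha> rho(2) by simp
    then show ?thesis
    proof (intro exI[of _ "1 / (\<alpha> * \<rho> ^ N)"] conjI allI impI, goal_cases)
      case 1
      then show ?case .
    next
      case 2
      then show ?case by (intro combine[OF \<alpha> _ _ le_1 N[THEN conjunct1]]) simp_all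
    next
      case 3
      then show ?case by (intro combine[OF \<alpha> _ _ le_1 N[THEN conjunct2]]) simp_all
    qed
  qed
  \<comment> \<open>\<open>C\<^sub>5\<close> and \<open>C\<^sub>7\<close> are \<open>exp 1\<close>,
    and the four other constants are 1; all dependence on \<open>\<epsilon>\<close>,
    \<open>\<alpha>\<close> and \<open>l\<close> sits in \<open>\<Lambda>\<close>.\<close>
  show ?thesis
    by (rule exI[of _ "exp 1"], rule conjI[OF exp_gt_zero], rule exI[of _ 1], rule conjI[OF zero_less_one],
        rule exI[of _ "exp 1"], rule conjI[OF exp_gt_zero], rule exI[of _ 1], rule conjI[OF zero_less_one],
        rule exI[of _ 1], rule conjI[OF zero_less_one], rule exI[of _ 1], rule conjI[OF zero_less_one],
        intro allI impI, rule main)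
qed

end
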